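(* Let $N\ge0$ and let $|\mathcal{C}_j^X(N)|=\#\{\mu\in W\Lambda_j:\ \mathrm{ht}(\Lambda_j-\mu)=N\}$ be the number of $j$-core abaci of type $X$ of height $N$. Then $$|\mathcal{C}_j^X(N)|=\begin{cases}\frac1{96}r_4(8N+6)=\frac14\sum_{d\mid 8N+6,\ 2\nmid d}d, & X=B_4^{(1)},\ j=2,\ N\text{ even};\\ \frac1{192}r_4(8N+6)=\frac18\sum_{d\mid 8N+6,\ 2\nmid d}d, & X=B_4^{(1)},\ j=2,\ N\text{ odd};\\ \frac1{24}r_4(6N+2)=\sum_{d\mid 6N+2,\ 2\nmid d}d, & X=D_4^{(1)},\ j=2,\ N\text{ odd}.\end{cases}$$
   Context: The types are given by their Cartan matrices $(a_{ik})=(\langle\alpha_i^\vee,\alpha_k\rangle)$, $i,k\in\{0,\dots,4\}$. - $B_4^{(1)}$: rows $(2,0,-1,0,0),(0,2,-1,0,0),(-1,-1,2,-1,0),(0,0,-1,2,-1),(0,0,0,-2,2)$. - $D_4^{(1)}$: $a_{ii}=2$, $a_{2i}=a_{i2}=-1$ for $i\in\{0,1,3,4\}$, and all other entries $0$. $\Lambda_j$ is the fundamental weight with $\langle\Lambda_j,\alpha_k^\vee\rangle=\delta_{jk}$. $W$ is generated by $\sigma_i(v)=v-\langle v,\alpha_i^\vee\rangle\alpha_i$. $\mathrm{ht}(\sum k_i\alpha_i)=\sum k_i$. In the paper's abacus model, $j$-core abaci of type $X$ correspond bijectively to elements $\mu=\Lambda_j-\beta$ of $W\Lambda_j$, with height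 $\mathrm{ht}(\beta)$. $r_4(n)$ is the number of $(x_1,\dots,x_4)\in\mathbb{Z}^4$ with $x_1^2+\dots+x_4^2=n$. The sums run over positive odd divisors $d$. *)

theory Defs
  imports
    "HOL-Algebra.Bij"
    "HOL-Algebra.Generated_Groups"
    "HOL-Analysis.Product_Vector"
begin

datatype affine_type = B4_1 | D4_1

text \<open>Nodes are \<open>0, \<dots>, 4\<close>; row \<open>i\<close>, column \<open>k\<close> is the pairing of the coroot
  \<open>\<alpha>\<^sub>i\<close>-check with the root \<open>\<alpha>\<^sub>k\<close>. Entries outside \<open>{..4} \<times> {..4}\<close> are irrelevant.\<close>

fun cartan :: "affine_type \<Rightarrow> nat \<Rightarrow> nat \<Rightarrow> int" where
  "cartan B4_1 i k =
     [[ 2,  0, -1,  0,  0],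
      [ 0,  2, -1,  0,  0],
      [-1, -1,  2, -1,  0],
      [ 0,  0, -1,  2, -1],
      [ 0,  0,  0, -2,  2]] ! i ! k"
| "cartan D4_1 i k =
     [[ 2,  0, -1,  0,  0],
      [ 0,  2, -1,  0,  0],
      [-1, -1,  2, -1, -1],
      [ 0,  0, -1,  2,  0],
      [ 0,  0, -1,  0,  2]] ! i ! k"

text \<open>The affine Cartan matrices are singular, so the simple roots are not determined by their
  pairings with the coroots; linear independence of the roots in the weight space \<open>'v\<close> is a separate
  requirement. The coroots are given as linear functionals on \<open>'v\<close>.\<close>

locale realization =
  fixes X :: affine_type
    and \<alpha> :: "nat \<Rightarrow> 'v::real_vector"
    and coroot :: "nat \<Rightarrow> 'v \<Rightarrow> real"
    and \<Lambda> :: "nat \<Rightarrow> 'v"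
  assumes linear_coroot: "i \<le> 4 \<Longrightarrow> linear (coroot i)"
    and inj_root: "inj_on \<alpha> {..4}"
    and independent_roots: "independent (\<alpha> ` {..4})"
    and coroot_root: "i \<le> 4 \<Longrightarrow> k \<le> 4 \<Longrightarrow> coroot i (\<alpha> k) = of_int (cartan X i k)"
    and coroot_fundamental: "j \<le> 4 \<Longrightarrow> k \<le> 4 \<Longrightarrow> coroot k (\<Lambda> j) = (if j = k then 1 else 0)"

definition simple_reflection ::
    "(nat \<Rightarrow> 'v::real_vector) \<Rightarrow> (nat \<Rightarrow> 'v \<Rightarrow> real) \<Rightarrow> nat \<Rightarrow> 'v \<Rightarrow> 'v" where
  "simple_reflection \<alpha> coroot i v = v - coroot i v *\<^sub>R \<alpha> i"

definition weyl_group ::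
    "(nat \<Rightarrow> 'v::real_vector) \<Rightarrow> (nat \<Rightarrow> 'v \<Rightarrow> real) \<Rightarrow> ('v \<Rightarrow> 'v) set" where
  "weyl_group \<alpha> coroot = generate (BijGroup UNIV) (simple_reflection \<alpha> coroot ` {..4})"

definition weyl_orbit ::
    "(nat \<Rightarrow> 'v::real_vector) \<Rightarrow> (nat \<Rightarrow> 'v \<Rightarrow> real) \<Rightarrow> 'v \<Rightarrow> 'v set" where
  "weyl_orbit \<alpha> coroot v = {w v | w. w \<in> weyl_group \<alpha> coroot}"

text \<open>\<^const>\<open>representation\<close> is \<open>0\<close> off the span of the simple roots, so \<open>ht\<close> is only
  meaningful there; differences of two elements of \<open>W\<Lambda>\<^sub>j\<close> always lie in that span.\<close>

definition ht :: "(nat \<Rightarrow> 'v::real_vector) \<Rightarrow> 'v \<Rightarrow> real" where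
  "ht \<alpha> v = (\<Sum>i\<le>4. representation (\<alpha> ` {..4}) v (\<alpha> i))"

definition cores ::
    "(nat \<Rightarrow> 'v::real_vector) \<Rightarrow> (nat \<Rightarrow> 'v \<Rightarrow> real) \<Rightarrow> (nat \<Rightarrow> 'v) \<Rightarrow> nat \<Rightarrow> nat \<Rightarrow> 'v set" where
  "cores \<alpha> coroot \<Lambda> j N = {\<mu> \<in> weyl_orbit \<alpha> coroot (\<Lambda> j). ht \<alpha> (\<Lambda> j - \<mu>) = real N}"

definition r4 :: "nat \<Rightarrow> nat" where
  "r4 n = card {(x1 :: int, x2 :: int, x3 :: int, x4 :: int).
             x1\<^sup>2 + x2\<^sup>2 + x3\<^sup>2 + x4\<^sup>2 = int n}"

definition odd_divisor_sum :: "nat \<Rightarrow> nat" where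
  "odd_divisor_sum n = (\<Sum>d | d dvd n \<and> odd d. d)"

lemma nodes_eq: "{..4::nat} = {0, 1, 2, 3, 4}"
  by auto

lemma (in realization) simple_reflection_in_BijGroup:
  assumes "i \<le> 4"
  shows "simple_reflection \<alpha> coroot i \<in> carrier (BijGroup UNIV)"
proof -
  interpret linear "coroot i"
    using assms by (rule linear_coroot)
  have "i \<in> {0, 1, 2, 3, 4}"
    using assms nodes_eq by blast
  then have "cartan X i i = 2"
    by (cases X) auto
  then have "coroot i (\<alpha> i) = 2"
    using coroot_root[OF assms assms] by simp
  then have "simple_reflection \<alpha> coroot i (simple_reflection \<alpha> coroot i v) = v" for v
    by (simp add: simple_reflection_def diff scale algebra_simps flip: scaleR_add_left)
  then have "bij (simple_reflection \<alpha> coroot i)"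
    by (metis bijI')
  then show ?thesis
    by (simp add: BijGroup_def Bij_def)
qed

text \<open>Realizations exist for both types: take the basis \<open>\<Lambda>\<^sub>0, \<dots>, \<Lambda>\<^sub>4, \<delta>\<close>, with all coroots
  vanishing on \<open>\<delta>\<close>, and put \<open>\<delta>\<close> with coefficient \<open>1\<close> into \<open>\<alpha>\<^sub>0\<close> only.\<close>

lemma realization_exists:
  "\<exists>\<alpha> coroot (\<Lambda> :: nat \<Rightarrow> real \<times> real \<times> real \<times> real \<times> real \<times> real).
     realization X \<alpha> coroot \<Lambda>"
proof -
  define A where "A i k = real_of_int (cartan X i k)" for i k
  define \<alpha> where "\<alpha> k = (A 0 k, A 1 k, A 2 k, A 3 k, A 4 k, if k = 0 then 1 else 0 :: real)" for k
  define \<Lambda> :: "nat \<Rightarrow> real \<times> real \<times> real \<times> real \<times> real \<times> real"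
    where "\<Lambda> j = (of_bool (j = 0), of_bool (j = 1), of_bool (j = 2),
                of_bool (j = 3), of_bool (j = 4), 0)" for j
  define coroot :: "nat \<Rightarrow> real \<times> real \<times> real \<times> real \<times> real \<times> real \<Rightarrow> real"
    where "coroot i = (\<lambda>(a, b, c, d, e, f). [a, b, c, d, e] ! i)" for i
  have cases5: "i = 0 \<or> i = 1 \<or> i = 2 \<or> i = 3 \<or> i = 4" if "i \<le> 4" for i :: nat
    using that by linarith
  have inj: "inj_on \<alpha> {..4}"
    by (cases X) (auto simp: inj_on_def \<alpha>_def A_def nodes_eq)
  have "realization X \<alpha> coroot \<Lambda>"
  proof (rule realization.intro)
    show "linear (coroot i)" if "i \<le> 4" for i
      using cases5[OF that] by (auto simp: coroot_def intro!: linearI)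
    show "inj_on \<alpha> {..4}" by (fact inj)
    show "independent (\<alpha> ` {..4})"
    proof
      assume "dependent (\<alpha> ` {..4})"
      then obtain u where u: "\<exists>v\<in>\<alpha> ` {..4}. u v \<noteq> 0" "(\<Sum>v\<in>\<alpha> ` {..4}. u v *\<^sub>R v) = 0"
        by (auto simp: real_vector.dependent_finite)
      define c where "c k = u (\<alpha> k)" for k
      have "(\<Sum>k\<le>4. c k *\<^sub>R \<alpha> k) = 0"
        using u(2) by (simp add: sum.reindex[OF inj] c_def)
      then have "c 0 = 0 \<and> c 1 = 0 \<and> c 2 = 0 \<and> c 3 = 0 \<and> c 4 = 0"
        by (cases X) (simp_all add: nodes_eq \<alpha>_def A_def zero_prod_def)
      with u(1) show False
        by (auto simp: c_def nodes_eq)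
    qed
    show "coroot i (\<alpha> k) = of_int (cartan X i k)" if "i \<le> 4" "k \<le> 4" for i k
      using cases5[OF that(1)] by (auto simp: coroot_def \<alpha>_def A_def)
    show "coroot k (\<Lambda> j) = (if j = k then 1 else 0)" if "j \<le> 4" "k \<le> 4" for j k
      using cases5[OF that(2)] by (auto simp: coroot_def \<Lambda>_def)
  qed
  then show ?thesis by blast
qed

end

theory Submission
  imports Defs
begin

text \<open>In the standard coordinates of the finite root system the orbit of \<open>\<Lambda>\<^sub>2\<close> consists of the vectors of
  \<open>\<int>\<^sup>4\<close> with exactly two odd entries, and completing the square turns the height into the value of a
  sum of four squares with prescribed residues: modulo 4 and equal to \<open>8 N + 6\<close> for \<open>B\<^sub>4\<close>, modulo 3 and
  equal to \<open>6 N + 2\<close> for \<open>D\<^sub>4\<close>. Signed permutations and parity-changing involutions compare these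
  counts with \<open>r\<^sub>4\<close>.

  For Jacobi's formula at even arguments, let \<open>a k\<close> be the number of representations of \<open>k\<close> by four odd
  squares. For \<open>M \<equiv> 5 (mod 8)\<close> symmetry among five odd squares gives
  \<open>\<Sum>\<^sub>x (M - 5 x\<^sup>2) a (M - x\<^sup>2) = 0\<close>, the sum running over odd \<open>x\<close>. A sign-reversing involution on the solutions of
  \<open>x\<^sup>2 + 4 y z = M\<close> gives the same recursion for \<open>\<sigma> ((M - x\<^sup>2) / 4)\<close>. Hence \<open>a (4 m) = 16 \<sigma> m\<close> for odd
  \<open>m\<close>, and \<open>(x, y) \<mapsto> (x + y, x - y)\<close> transports this to \<open>r\<^sub>4 (2 m) = 24 \<sigma> m\<close> and
  \<open>r\<^sub>4 (4 n) = r\<^sub>4 (2 n)\<close>.\<close>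

section \<open>Representations by four squares\<close>

text \<open>The side condition stays apart from the quadratic equation, so that a symmetry of the
  sum of squares rewrites \<open>P\<close> alone.\<close>

definition reps :: "int \<Rightarrow> (int \<Rightarrow> int \<Rightarrow> int \<Rightarrow> int \<Rightarrow> bool) \<Rightarrow> nat" where
  "reps n P = card {(a, b, c, d). a\<^sup>2 + b\<^sup>2 + c\<^sup>2 + d\<^sup>2 = n \<and> P a b c d}"

lemma abs_le_of_square_le:
  fixes x n :: int
  assumes "x\<^sup>2 \<le> n"
  shows "\<bar>x\<bar> \<le> n"
proof -
  have "\<bar>x\<bar> * 1 \<le> \<bar>x\<bar> * \<bar>x\<bar>"
    by (cases "x = 0") (simp, intro mult_left_mono, auto)
  also have "\<dots> = x\<^sup>2"
    by (simp add: power2_eq_square)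
  finally show ?thesis
    using assms by simp
qed

lemma finite_reps: "finite {(a, b, c, d). a\<^sup>2 + b\<^sup>2 + c\<^sup>2 + d\<^sup>2 = (n::int) \<and> P a b c d}"
proof (rule finite_subset)
  show "{(a, b, c, d). a\<^sup>2 + b\<^sup>2 + c\<^sup>2 + d\<^sup>2 = n \<and> P a b c d}
    \<subseteq> {-n..n} \<times> {-n..n} \<times> {-n..n} \<times> {-n..n}"
  proof
    fix t
    assume "t \<in> {(a, b, c, d). a\<^sup>2 + b\<^sup>2 + c\<^sup>2 + d\<^sup>2 = n \<and> P a b c d}"
    then obtain a b c d where t: "t = (a, b, c, d)" and n: "a\<^sup>2 + b\<^sup>2 + c\<^sup>2 + d\<^sup>2 = n"
      by auto
    have "0 \<le> a\<^sup>2" "0 \<le> b\<^sup>2" "0 \<le> c\<^sup>2" "0 \<le> d\<^sup>2"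
      by simp_all
    then have "a\<^sup>2 \<le> n" "b\<^sup>2 \<le> n" "c\<^sup>2 \<le> n" "d\<^sup>2 \<le> n"
      using n by linarith+
    then have "\<bar>a\<bar> \<le> n" "\<bar>b\<bar> \<le> n" "\<bar>c\<bar> \<le> n" "\<bar>d\<bar> \<le> n"
      by (simp_all add: abs_le_of_square_le)
    then show "t \<in> {-n..n} \<times> {-n..n} \<times> {-n..n} \<times> {-n..n}"
      by (auto simp: t)
  qed
qed simp

lemma r4_eq_reps: "r4 n = reps (int n) (\<lambda>_ _ _ _. True)"
  by (simp add: r4_def reps_def)

lemma reps_cong:
  assumes "\<And>a b c d. a\<^sup>2 + b\<^sup>2 + c\<^sup>2 + d\<^sup>2 = n \<Longrightarrow> P a b c d = Q a b c d"
  shows "reps n P = reps n Q"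
  unfolding reps_def by (rule arg_cong[where f = card]) (use assms in auto)

lemma reps_split:
  "reps n P = reps n (\<lambda>a b c d. P a b c d \<and> Q a b c d) + reps n (\<lambda>a b c d. P a b c d \<and> \<not> Q a b c d)"
  unfolding reps_def
  by (subst card_Un_disjoint[symmetric]) (auto intro: finite_reps intro!: arg_cong[where f = card])

text \<open>\<open>f\<close> and \<open>g\<close> have to be mutually inverse only on solutions,
  which admits inverses written with \<open>div\<close>. The two norms may differ, so scaling maps
  are covered.\<close>

lemma reps_bij:
  fixes f g :: "int \<times> int \<times> int \<times> int \<Rightarrow> int \<times> int \<times> int \<times> int"
  assumes "\<And>a b c d. a\<^sup>2 + b\<^sup>2 + c\<^sup>2 + d\<^sup>2 = n \<Longrightarrow> P a b c d \<Longrightarrow>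
      (case f (a, b, c, d) of (a, b, c, d) \<Rightarrow> a\<^sup>2 + b\<^sup>2 + c\<^sup>2 + d\<^sup>2 = m \<and> Q a b c d)
      \<and> g (f (a, b, c, d)) = (a, b, c, d)"
    and "\<And>a b c d. a\<^sup>2 + b\<^sup>2 + c\<^sup>2 + d\<^sup>2 = m \<Longrightarrow> Q a b c d \<Longrightarrow>
      (case g (a, b, c, d) of (a, b, c, d) \<Rightarrow> a\<^sup>2 + b\<^sup>2 + c\<^sup>2 + d\<^sup>2 = n \<and> P a b c d)
      \<and> f (g (a, b, c, d)) = (a, b, c, d)"
  shows "reps n P = reps m Q"
proof -
  define A where "A = {(a, b, c, d). a\<^sup>2 + b\<^sup>2 + c\<^sup>2 + d\<^sup>2 = n \<and> P a b c d}"
  define B where "B = {(a, b, c, d). a\<^sup>2 + b\<^sup>2 + c\<^sup>2 + d\<^sup>2 = m \<and> Q a b c d}"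
  have "f t \<in> B \<and> g (f t) = t" if "t \<in> A" for t
    using assms(1) that unfolding A_def B_def by (cases t) (simp add: case_prod_unfold)
  moreover have "g t \<in> A \<and> f (g t) = t" if "t \<in> B" for t
    using assms(2) that unfolding A_def B_def by (cases t) (simp add: case_prod_unfold)
  ultimately have "bij_betw f A B"
    by (intro bij_betw_byWitness[where f' = g]) auto
  then show ?thesis
    unfolding reps_def A_def B_def by (rule bij_betw_same_card)
qed

text \<open>This and the next five lemmas supply adjacent transpositions and sign changes; each
  preserves the norm and is its own inverse.\<close>

lemma reps_swap12: "reps n P = reps n (\<lambda>a b c d. P b a c d)"
  by (rule reps_bij[where f = "\<lambda>(a, b, c, d). (b, a, c, d)" and g = "\<lambda>(a, b, c, d). (b, a, c, d)"])
    (auto simp: algebra_simps)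

lemma reps_swap23: "reps n P = reps n (\<lambda>a b c d. P a c b d)"
  by (rule reps_bij[where f = "\<lambda>(a, b, c, d). (a, c, b, d)" and g = "\<lambda>(a, b, c, d). (a, c, b, d)"])
    (auto simp: algebra_simps)

lemma reps_swap34: "reps n P = reps n (\<lambda>a b c d. P a b d c)"
  by (rule reps_bij[where f = "\<lambda>(a, b, c, d). (a, b, d, c)" and g = "\<lambda>(a, b, c, d). (a, b, d, c)"])
    (auto simp: algebra_simps)

lemma reps_minus2: "reps n P = reps n (\<lambda>a b c d. P a (-b) c d)"
  by (rule reps_bij[where f = "\<lambda>(a, b, c, d). (a, -b, c, d)" and g = "\<lambda>(a, b, c, d). (a, -b, c, d)"])
    auto

lemma reps_minus3: "reps n P = reps n (\<lambda>a b c d. P a b (-c) d)"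
  by (rule reps_bij[where f = "\<lambda>(a, b, c, d). (a, b, -c, d)" and g = "\<lambda>(a, b, c, d). (a, b, -c, d)"])
    auto

lemma reps_minus4: "reps n P = reps n (\<lambda>a b c d. P a b c (-d))"
  by (rule reps_bij[where f = "\<lambda>(a, b, c, d). (a, b, c, -d)" and g = "\<lambda>(a, b, c, d). (a, b, c, -d)"])
    auto

section \<open>Four odd squares\<close>

text \<open>These are the binary quadratic forms with coefficients \<open>(-y, x, z)\<close>, so of
  discriminant \<open>M\<close> with outer coefficients of opposite signs.\<close>

definition discr_triples :: "int \<Rightarrow> (int \<times> int \<times> int) set" where
  "discr_triples M = {(x, y, z). 0 < y \<and> 0 < z \<and> x\<^sup>2 + 4 * y * z = M}"

lemma finite_discr_triples: "finite (discr_triples M)"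
proof (rule finite_subset)
  show "discr_triples M \<subseteq> {-M..M} \<times> {0..M} \<times> {0..M}"
  proof
    fix t
    assume "t \<in> discr_triples M"
    then obtain x y z where t: "t = (x, y, z)" and pos: "0 < y" "0 < z" and M: "x\<^sup>2 + 4 * (y * z) = M"
      by (auto simp: discr_triples_def mult.assoc)
    have "y * 1 \<le> y * z" "1 * z \<le> y * z"
      using pos by (intro mult_left_mono mult_right_mono; simp)+
    moreover have "\<bar>x\<bar> \<le> x\<^sup>2" "0 \<le> x\<^sup>2"
      by (simp_all add: abs_le_of_square_le)
    ultimately have "\<bar>x\<bar> \<le> M" "y \<le> M" "z \<le> M"
      using M pos by linarith+
    then show "t \<in> {-M..M} \<times> {0..M} \<times> {0..M}"
      using pos by (auto simp: t)
  qed
qed simp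

lemma odd_square_mod_8:
  fixes x :: int
  assumes "odd x"
  shows "x\<^sup>2 mod 8 = 1"
proof -
  from assms obtain k where k: "x = 2 * k + 1"
    by (rule oddE)
  have "even (k * (k + 1))"
    by simp
  then obtain l where "k * (k + 1) = 2 * l"
    by (rule evenE)
  then have "x\<^sup>2 = 8 * l + 1"
    using k by (simp add: power2_eq_square algebra_simps)
  then show ?thesis
    by simp
qed

lemma even_square_mod_8:
  fixes x :: int
  assumes "even x"
  shows "x\<^sup>2 mod 8 = (if 4 dvd x then 0 else 4)"
proof -
  from assms obtain k where k: "x = 2 * k"
    by (rule evenE)
  show ?thesis
  proof (cases "even k")
    case True
    then obtain l where "k = 2 * l"
      by (rule evenE)
    then have "x\<^sup>2 = 8 * (2 * l\<^sup>2)" "4 dvd x"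
      using k by (simp_all add: power2_eq_square)
    then show ?thesis
      by simp
  next
    case False
    have "x\<^sup>2 = 4 * k\<^sup>2"
      using k by (simp add: power2_eq_square)
    moreover have "\<not> 4 dvd x"
      using k False by presburger
    moreover have "k\<^sup>2 mod 8 = 1"
      using False by (rule odd_square_mod_8)
    ultimately show ?thesis
      by presburger
  qed
qed

text \<open>A triple is an edge of Conway's river for the form with coefficients \<open>(-y, x, z)\<close>; the third
  value at one end of the edge is \<open>w = z + x - y\<close>. The involution moves to the other river edge
  at that end, exchanging \<open>w\<close> with the coefficient of the same sign, and the product of differences
  of \<open>-y\<close>, \<open>z\<close>, \<open>w\<close> is alternating.\<close>

lemma sum_discr_triples_alternating:
  assumes M: "M mod 8 = (5::int)"
  shows "(\<Sum>(x, y, z)\<in>discr_triples M. (y + z) * (y - x) * (z + x)) = 0"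
proof -
  define G :: "int \<times> int \<times> int \<Rightarrow> int" where "G = (\<lambda>(x, y, z). (y + z) * (y - x) * (z + x))"
  define f :: "int \<times> int \<times> int \<Rightarrow> int \<times> int \<times> int" where
    "f = (\<lambda>(x, y, z). if z + x - y > 0 then (2 * y - x, y, z + x - y) else (- x - 2 * z, y - z - x, z))"
  \<comment> \<open>If \<open>w = 0\<close>, the form represents zero and its discriminant is a
    square, but no square is 5 modulo 8. So the sign of \<open>w\<close> always selects a branch of
    \<open>f\<close>.\<close>
  have nz: "z + x - y \<noteq> 0" if "(x, y, z) \<in> discr_triples M" for x y z
  proof
    assume "z + x - y = 0"
    then have "M = (x + 2 * z)\<^sup>2"
      using that by (auto simp: discr_triples_def power2_eq_square algebra_simps)
    moreover have "u\<^sup>2 mod 8 \<noteq> 5" for u :: int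
      using odd_square_mod_8[of u] even_square_mod_8[of u] by (cases "even u") auto
    ultimately show False
      using M by blast
  qed
  have f: "f t \<in> discr_triples M \<and> f (f t) = t \<and> G (f t) = - G t" if "t \<in> discr_triples M" for t
  proof -
    obtain x y z where t: "t = (x, y, z)"
      by (cases t)
    show ?thesis
      using that nz[of x y z] unfolding t
      by (auto simp: f_def G_def discr_triples_def power2_eq_square algebra_simps)
  qed
  have "sum G (discr_triples M) = (\<Sum>t\<in>discr_triples M. - G t)"
    by (rule sum.reindex_bij_witness[where i = f and j = f]) (use f in auto)
  then show ?thesis
    by (simp add: sum_negf G_def)
qed

text \<open>Adding the alternating sum to its image under \<open>x\<close> -> \<open>-x\<close>
  cancels the odd powers of \<open>x\<close> and leaves
  \<open>2 * (y + z) * (y * z - x\<^sup>2)\<close>. Exchanging \<open>y\<close> and \<open>z\<close>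
  shows that the two summands of \<open>y + z\<close> contribute equally.\<close>

lemma sum_discr_triples:
  assumes "M mod 8 = (5::int)"
  shows "(\<Sum>(x, y, z)\<in>discr_triples M. y * (y * z - x\<^sup>2)) = 0"
proof -
  let ?T = "discr_triples M"
  have "(\<Sum>(x, y, z)\<in>?T. (y + z) * (y - x) * (z + x)) = (\<Sum>(x, y, z)\<in>?T. (y + z) * (y + x) * (z - x))"
    by (rule sum.reindex_bij_witness[where i = "\<lambda>(x, y, z). (-x, y, z)" and j = "\<lambda>(x, y, z). (-x, y, z)"])
      (auto simp: discr_triples_def)
  then have "0 = (\<Sum>(x, y, z)\<in>?T. (y + z) * (y - x) * (z + x)) + (\<Sum>(x, y, z)\<in>?T. (y + z) * (y + x) * (z - x))"
    using sum_discr_triples_alternating[OF assms] by simp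
  also have "\<dots> = (\<Sum>(x, y, z)\<in>?T. 2 * (y * (y * z - x\<^sup>2)) + 2 * (z * (y * z - x\<^sup>2)))"
    by (subst sum.distrib[symmetric]) (auto intro!: sum.cong simp: power2_eq_square algebra_simps)
  also have "\<dots> = 2 * (\<Sum>(x, y, z)\<in>?T. y * (y * z - x\<^sup>2)) + 2 * (\<Sum>(x, y, z)\<in>?T. z * (y * z - x\<^sup>2))"
    by (simp add: sum.distrib sum_distrib_left case_prod_unfold)
  also have "(\<Sum>(x, y, z)\<in>?T. z * (y * z - x\<^sup>2)) = (\<Sum>(x, y, z)\<in>?T. y * (y * z - x\<^sup>2))"
    by (rule sum.reindex_bij_witness[where i = "\<lambda>(x, y, z). (x, z, y)" and j = "\<lambda>(x, y, z). (x, z, y)"])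
      (auto simp: discr_triples_def algebra_simps)
  finally show ?thesis
    by simp
qed

text \<open>The divisor sum of \<open>k / 4\<close>, and 0 unless \<open>k\<close> is a positive
  multiple of 4. Summing over factorizations makes it a sum over the fibres of
  \<open>discr_triples\<close> above fixed \<open>x\<close>.\<close>

definition sigma4 :: "int \<Rightarrow> int" where
  "sigma4 k = (\<Sum>(y, z) | 0 < y \<and> 0 < z \<and> 4 * y * z = k. y)"

definition odd_reps :: "int \<Rightarrow> nat" where
  "odd_reps k = reps k (\<lambda>a b c d. odd a \<and> odd b \<and> odd c \<and> odd d)"

text \<open>On a triple \<open>4 * y * z = M - x\<^sup>2\<close>, hence
  \<open>4 * y * (y * z - x\<^sup>2) = (M - 5 * x\<^sup>2) * y\<close>. Grouping the vanishing sum
  over triples by \<open>x\<close> gives the claim; \<open>x\<close> is odd because \<open>M\<close>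
  is.\<close>

lemma sigma4_recursion:
  assumes M: "M mod 8 = (5::int)"
  shows "(\<Sum>x | odd x \<and> \<bar>x\<bar> \<le> M. (M - 5 * x\<^sup>2) * sigma4 (M - x\<^sup>2)) = 0"
proof -
  let ?X = "{x. odd x \<and> \<bar>x\<bar> \<le> M}"
  let ?F = "\<lambda>x. {(y, z). 0 < y \<and> 0 < z \<and> 4 * y * z = M - x\<^sup>2}"
  have T: "discr_triples M = Sigma ?X ?F"
  proof -
    have "odd x \<and> \<bar>x\<bar> \<le> M" if "0 < y" "0 < z" "x\<^sup>2 + 4 * y * z = M" for x y z :: int
    proof -
      have "0 < y * z"
        using that by simp
      then have "x\<^sup>2 \<le> M"
        using that(3) by (simp add: mult.assoc)
      moreover have "odd M"
        using M by presburger
      then have "odd (x\<^sup>2)"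
        using that(3) by (metis dvd_add dvd_mult2 even_numeral)
      ultimately show ?thesis
        by (simp add: abs_le_of_square_le)
    qed
    then show ?thesis
      by (auto simp: discr_triples_def)
  qed
  have finX: "finite ?X"
    by (rule finite_subset[of _ "{-M..M}"]) auto
  have finF: "finite (?F x)" for x
  proof (rule finite_subset)
    show "?F x \<subseteq> snd ` discr_triples M"
      by (force simp: discr_triples_def image_iff)
  qed (simp add: finite_discr_triples)
  have "(\<Sum>x\<in>?X. (M - 5 * x\<^sup>2) * sigma4 (M - x\<^sup>2)) = (\<Sum>x\<in>?X. \<Sum>(y, z)\<in>?F x. (M - 5 * x\<^sup>2) * y)"
    by (simp add: sigma4_def sum_distrib_left case_prod_unfold)
  also have "\<dots> = (\<Sum>(x, y, z)\<in>discr_triples M. (M - 5 * x\<^sup>2) * y)"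
    unfolding T by (subst sum.Sigma) (use finX finF in auto)
  also have "\<dots> = (\<Sum>(x, y, z)\<in>discr_triples M. 4 * (y * (y * z - x\<^sup>2)))"
    by (rule sum.cong) (auto simp: discr_triples_def algebra_simps)
  also have "\<dots> = 0"
    using sum_discr_triples[OF M] by (simp add: sum_distrib_left[symmetric] case_prod_unfold)
  finally show ?thesis .
qed

text \<open>By symmetry each of five odd squares with sum \<open>M\<close> has average \<open>M / 5\<close>.\<close>

lemma odd_reps_recursion:
  "(\<Sum>x | odd x \<and> \<bar>x\<bar> \<le> M. (M - 5 * x\<^sup>2) * int (odd_reps (M - x\<^sup>2))) = 0"
proof -
  let ?X = "{x. odd x \<and> \<bar>x\<bar> \<le> M}"
  let ?F = "\<lambda>x. {(a, b, c, d). a\<^sup>2 + b\<^sup>2 + c\<^sup>2 + d\<^sup>2 = M - x\<^sup>2 \<and> odd a \<and> odd b \<and> odd c \<and> odd d}"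
  define S where "S = {(x, a, b, c, d). x\<^sup>2 + a\<^sup>2 + b\<^sup>2 + c\<^sup>2 + d\<^sup>2 = M
    \<and> odd x \<and> odd a \<and> odd b \<and> odd c \<and> odd d}"
  have finX: "finite ?X"
    by (rule finite_subset[of _ "{-M..M}"]) auto
  have S: "S = Sigma ?X ?F"
  proof -
    have "\<bar>x\<bar> \<le> M" if "x\<^sup>2 + a\<^sup>2 + b\<^sup>2 + c\<^sup>2 + d\<^sup>2 = M" for x a b c d :: int
    proof (rule abs_le_of_square_le)
      have "0 \<le> a\<^sup>2" "0 \<le> b\<^sup>2" "0 \<le> c\<^sup>2" "0 \<le> d\<^sup>2"
        by simp_all
      then show "x\<^sup>2 \<le> M"
        using that by linarith
    qed
    then show ?thesis
      by (auto simp: S_def)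
  qed
  have "(\<Sum>x\<in>?X. (M - 5 * x\<^sup>2) * int (odd_reps (M - x\<^sup>2))) = (\<Sum>x\<in>?X. \<Sum>_\<in>?F x. M - 5 * x\<^sup>2)"
    by (simp add: odd_reps_def reps_def mult.commute)
  also have "\<dots> = (\<Sum>(x, a, b, c, d)\<in>S. M - 5 * x\<^sup>2)"
    unfolding S by (subst sum.Sigma) (use finX finite_reps in \<open>auto simp: case_prod_unfold\<close>)
  also have "\<dots> = (\<Sum>(x, a, b, c, d)\<in>S. x\<^sup>2 + a\<^sup>2 + b\<^sup>2 + c\<^sup>2 + d\<^sup>2) - 5 * (\<Sum>(x, a, b, c, d)\<in>S. x\<^sup>2)"
    unfolding sum_distrib_left sum_subtractf[symmetric]
    by (rule sum.cong) (auto simp: S_def)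
  also have "(\<Sum>(x, a, b, c, d)\<in>S. x\<^sup>2 + a\<^sup>2 + b\<^sup>2 + c\<^sup>2 + d\<^sup>2) =
      (\<Sum>(x, a, b, c, d)\<in>S. x\<^sup>2) + (\<Sum>(x, a, b, c, d)\<in>S. a\<^sup>2) + (\<Sum>(x, a, b, c, d)\<in>S. b\<^sup>2)
      + (\<Sum>(x, a, b, c, d)\<in>S. c\<^sup>2) + (\<Sum>(x, a, b, c, d)\<in>S. d\<^sup>2)"
    by (simp add: sum.distrib case_prod_unfold)
  also have "(\<Sum>(x, a, b, c, d)\<in>S. a\<^sup>2) = (\<Sum>(x, a, b, c, d)\<in>S. x\<^sup>2)"
    by (rule sum.reindex_bij_witness[where i = "\<lambda>(x, a, b, c, d). (a, x, b, c, d)"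
          and j = "\<lambda>(x, a, b, c, d). (a, x, b, c, d)"]) (auto simp: S_def)
  also have "(\<Sum>(x, a, b, c, d)\<in>S. b\<^sup>2) = (\<Sum>(x, a, b, c, d)\<in>S. x\<^sup>2)"
    by (rule sum.reindex_bij_witness[where i = "\<lambda>(x, a, b, c, d). (b, a, x, c, d)"
          and j = "\<lambda>(x, a, b, c, d). (b, a, x, c, d)"]) (auto simp: S_def)
  also have "(\<Sum>(x, a, b, c, d)\<in>S. c\<^sup>2) = (\<Sum>(x, a, b, c, d)\<in>S. x\<^sup>2)"
    by (rule sum.reindex_bij_witness[where i = "\<lambda>(x, a, b, c, d). (c, a, b, x, d)"
          and j = "\<lambda>(x, a, b, c, d). (c, a, b, x, d)"]) (auto simp: S_def)
  also have "(\<Sum>(x, a, b, c, d)\<in>S. d\<^sup>2) = (\<Sum>(x, a, b, c, d)\<in>S. x\<^sup>2)"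
    by (rule sum.reindex_bij_witness[where i = "\<lambda>(x, a, b, c, d). (d, a, b, c, x)"
          and j = "\<lambda>(x, a, b, c, d). (d, a, b, c, x)"]) (auto simp: S_def)
  finally show ?thesis
    by linarith
qed

section \<open>From the two recursions to the count of four odd squares\<close>

lemma odd_square_ge_1: "odd (x::int) \<Longrightarrow> 1 \<le> x\<^sup>2"
proof -
  assume "odd x"
  then have "0 < x\<^sup>2"
    by (auto simp: zero_less_power2)
  then show ?thesis
    by linarith
qed

lemma odd_reps_4: "odd_reps 4 = 16"
proof -
  have one: "a\<^sup>2 = 1 \<and> b\<^sup>2 = 1 \<and> c\<^sup>2 = 1 \<and> d\<^sup>2 = 1"
    if "a\<^sup>2 + b\<^sup>2 + c\<^sup>2 + d\<^sup>2 = 4" "odd a" "odd b" "odd c" "odd d" for a b c d :: int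
    using that odd_square_ge_1[of a] odd_square_ge_1[of b] odd_square_ge_1[of c] odd_square_ge_1[of d]
    by linarith
  have "{(a::int, b::int, c::int, d::int). a\<^sup>2 + b\<^sup>2 + c\<^sup>2 + d\<^sup>2 = 4 \<and> odd a \<and> odd b \<and> odd c \<and> odd d}
      = {-1, 1} \<times> {-1, 1} \<times> {-1, 1} \<times> {-1, 1}" (is "?L = ?R")
  proof
    show "?L \<subseteq> ?R"
    proof
      fix t
      assume "t \<in> ?L"
      then obtain a b c d where t: "t = (a, b, c, d)" and "a\<^sup>2 + b\<^sup>2 + c\<^sup>2 + d\<^sup>2 = 4"
        "odd a" "odd b" "odd c" "odd d"
        by blast
      then have "a\<^sup>2 = 1 \<and> b\<^sup>2 = 1 \<and> c\<^sup>2 = 1 \<and> d\<^sup>2 = 1"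
        by (intro one)
      then have "a \<in> {-1, 1}" "b \<in> {-1, 1}" "c \<in> {-1, 1}" "d \<in> {-1, 1}"
        by (simp_all add: power2_eq_1_iff disj_commute)
      then show "t \<in> ?R"
        unfolding t by (intro SigmaI)
    qed
  qed auto
  then show ?thesis
    by (simp add: odd_reps_def reps_def card_cartesian_product)
qed

lemma sigma4_4: "sigma4 4 = 1"
proof -
  have "{(y::int, z::int). 0 < y \<and> 0 < z \<and> 4 * y * z = 4} = {(1, 1)}"
    by (auto simp: mult.assoc zmult_eq_1_iff)
  then show ?thesis
    by (simp add: sigma4_def)
qed

lemma odd_reps_nonpos: "k \<le> 0 \<Longrightarrow> odd_reps k = 0"
proof -
  assume "k \<le> 0"
  then have "{(a::int, b::int, c::int, d::int). a\<^sup>2 + b\<^sup>2 + c\<^sup>2 + d\<^sup>2 = k \<and> odd a \<and> odd b \<and> odd c \<and> odd d} = {}"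
    using odd_square_ge_1 by (fastforce dest!: odd_square_ge_1)
  then show ?thesis
    by (simp only: odd_reps_def reps_def card.empty)
qed

lemma sigma4_nonpos: "k \<le> 0 \<Longrightarrow> sigma4 k = 0"
proof -
  assume "k \<le> 0"
  moreover have "0 < 4 * y * z" if "0 < y" "0 < z" for y z :: int
    using that by simp
  ultimately have "{(y::int, z::int). 0 < y \<and> 0 < z \<and> 4 * y * z = k} = {}"
    by fastforce
  then show ?thesis
    by (simp only: sigma4_def sum.empty)
qed

text \<open>Both sides satisfy the same recursion with \<open>M = k + 1\<close>. The terms
  \<open>x = 1\<close> and \<open>x = -1\<close> carry the value at \<open>k\<close> with factor
  \<open>M - 5 = k - 4\<close>; all others concern smaller arguments. The factor vanishes only at
  \<open>k = 4\<close>, which is therefore the base case.\<close>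

lemma odd_reps_eq_sigma4:
  assumes "k mod 8 = 4"
  shows "int (odd_reps k) = 16 * sigma4 k"
  using assms
proof (induction "nat k" arbitrary: k rule: less_induct)
  case less
  define h where "h k = int (odd_reps k) - 16 * sigma4 k" for k
  consider "k \<le> 0" | "k = 4" | "k > 4"
    using less.prems by atomize_elim presburger
  then show ?case
  proof cases
    case 1
    then show ?thesis
      by (simp add: odd_reps_nonpos sigma4_nonpos)
  next
    case 2
    then show ?thesis
      by (simp add: odd_reps_4 sigma4_4)
  next
    case 3
    define M where "M = k + 1"
    let ?X = "{x. odd x \<and> \<bar>x\<bar> \<le> M}"
    have M: "M mod 8 = 5"
      using less.prems unfolding M_def by presburger
    have finX: "finite ?X"
      by (rule finite_subset[of _ "{-M..M}"]) auto
    \<comment> \<open>An odd \<open>x\<close> other than 1 and -1 leads to an argument below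
      \<open>k\<close> that is again 4 modulo 8, or to a nonpositive one, where both functions
      vanish.\<close>
    have zero: "h (M - x\<^sup>2) = 0" if "odd x" "x \<noteq> 1" "x \<noteq> -1" for x
    proof (cases "M - x\<^sup>2 \<le> 0")
      case True
      then show ?thesis
        by (simp add: h_def odd_reps_nonpos sigma4_nonpos)
    next
      case False
      have "x\<^sup>2 \<noteq> 1"
        using that by (simp add: power2_eq_1_iff)
      then have "nat (M - x\<^sup>2) < nat k"
        using odd_square_ge_1[OF \<open>odd x\<close>] False 3 by (simp add: M_def)
      moreover have "(M - x\<^sup>2) mod 8 = 4"
        using M odd_square_mod_8[OF \<open>odd x\<close>] by presburger
      ultimately show ?thesis
        using less.hyps[of "M - x\<^sup>2"] by (simp add: h_def)
    qed
    have "0 = (\<Sum>x\<in>?X. (M - 5 * x\<^sup>2) * int (odd_reps (M - x\<^sup>2)))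
        - 16 * (\<Sum>x\<in>?X. (M - 5 * x\<^sup>2) * sigma4 (M - x\<^sup>2))"
      using sigma4_recursion[OF M] odd_reps_recursion[of M] by simp
    also have "\<dots> = (\<Sum>x\<in>?X. (M - 5 * x\<^sup>2) * h (M - x\<^sup>2))"
      unfolding sum_distrib_left sum_subtractf[symmetric] h_def
      by (rule sum.cong) (auto simp: algebra_simps)
    also have "\<dots> = (\<Sum>x\<in>{-1, 1}. (M - 5 * x\<^sup>2) * h (M - x\<^sup>2))"
      by (rule sum.mono_neutral_right[OF finX]) (use 3 zero in \<open>auto simp: M_def\<close>)
    also have "\<dots> = 2 * (M - 5) * h k"
      by (simp add: M_def)
    finally show ?thesis
      using 3 by (simp add: h_def M_def)
  qed
qed

text \<open>All divisors of an odd \<open>m\<close> are odd, and in \<open>m = y * z\<close> the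
  factor \<open>z\<close> is determined by \<open>y\<close>.\<close>

lemma sigma4_eq_odd_divisor_sum:
  assumes "odd m"
  shows "sigma4 (4 * int m) = int (odd_divisor_sum m)"
proof -
  have m: "m > 0"
    using assms by (rule odd_pos)
  have "sigma4 (4 * int m) = (\<Sum>d | d dvd m \<and> odd d. int d)"
    unfolding sigma4_def
  proof (rule sum.reindex_bij_witness[where i = "\<lambda>d. (int d, int (m div d))" and j = "nat \<circ> fst"])
    fix p :: "int \<times> int"
    assume p: "p \<in> {(y, z). 0 < y \<and> 0 < z \<and> 4 * y * z = 4 * int m}"
    obtain y z where yz: "p = (y, z)" "0 < y" "0 < z" "int m = y * z"
    proof -
      obtain y z where yz: "p = (y, z)"
        by (cases p)
      have "4 * (y * z) = 4 * int m"
        using p unfolding yz by (simp add: mult.assoc)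
      then have "int m = y * z"
        by simp
      then show thesis
        using p that[OF yz] unfolding yz by simp
    qed
    define u v where "u = nat y" and "v = nat z"
    have uv: "y = int u" "z = int v"
      using yz by (simp_all add: u_def v_def)
    have "int m = int (u * v)"
      using yz(4) by (simp only: uv of_nat_mult)
    then have uv': "m = u * v"
      by (simp only: of_nat_eq_iff)
    have "u > 0"
      using yz(2) uv(1) by simp
    then show "(int ((nat \<circ> fst) p), int (m div (nat \<circ> fst) p)) = p"
      by (simp add: yz(1) uv uv')
    show "(nat \<circ> fst) p \<in> {d. d dvd m \<and> odd d}"
      using assms by (simp add: yz(1) uv uv')
    show "int ((nat \<circ> fst) p) = (case p of (y, z) \<Rightarrow> y)"
      by (simp add: yz(1) uv)
  next
    fix d
    assume "d \<in> {d. d dvd m \<and> odd d}"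
    then have "d dvd m"
      by simp
    then obtain e where "m = d * e" ..
    then show "(int d, int (m div d)) \<in> {(y, z). 0 < y \<and> 0 < z \<and> 4 * y * z = 4 * int m}"
      using m by simp
  qed simp
  then show ?thesis
    by (simp add: odd_divisor_sum_def)
qed

lemma odd_divisor_sum_double: "odd_divisor_sum (2 * n) = odd_divisor_sum n"
proof -
  have "d dvd 2 * n \<longleftrightarrow> d dvd n" if "odd d" for d
    using that by (simp add: coprime_dvd_mult_right_iff)
  then have "{d. d dvd 2 * n \<and> odd d} = {d. d dvd n \<and> odd d}"
    by blast
  then show ?thesis
    by (simp only: odd_divisor_sum_def)
qed

section \<open>Jacobi's theorem for even numbers\<close>

lemma square_mod_4: "x\<^sup>2 mod 4 = (x::int) mod 2"
proof (cases "even x")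
  case True
  then show ?thesis
    by (auto elim!: evenE simp: power2_eq_square)
next
  case False
  then show ?thesis
    using odd_square_mod_8[of x] by presburger
qed

lemma sum_squares_mod_4:
  "(a\<^sup>2 + b\<^sup>2 + c\<^sup>2 + d\<^sup>2) mod 4 = (a mod 2 + b mod 2 + c mod 2 + (d::int) mod 2) mod 4"
  unfolding square_mod_4[symmetric] by (intro mod_add_cong) simp_all

text \<open>The map \<open>(a, b)\<close> -> \<open>(a + b, a - b)\<close> on both pairs doubles the
  norm. Its image is cut out by the two parity conditions, under which the halvings in the inverse
  are exact.\<close>

lemma reps_double:
  "reps n (\<lambda>a b c d. P (a + b) (a - b) (c + d) (c - d))
    = reps (2 * n) (\<lambda>a b c d. even (a + b) \<and> even (c + d) \<and> P a b c d)"
proof (rule reps_bij[where f = "\<lambda>(a, b, c, d). (a + b, a - b, c + d, c - d)"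
        and g = "\<lambda>(a, b, c, d). ((a + b) div 2, (a - b) div 2, (c + d) div 2, (c - d) div 2)"], goal_cases)
  case (1 a b c d)
  then show ?case
    by (auto simp: power2_eq_square algebra_simps)
next
  case (2 a b c d)
  then have "even (a + b)" "even (c + d)"
    by blast+
  then obtain k l where "a + b = 2 * k" "c + d = 2 * l"
    by (elim evenE)
  then have eq: "a = 2 * k - b" "c = 2 * l - d"
    by simp_all
  have "(2 * k - b - b) div 2 = k - b" "(2 * l - d - d) div 2 = l - d"
    by simp_all
  with 2 show ?case
    unfolding eq by (simp add: power2_eq_square algebra_simps)
qed

text \<open>In a representation of a multiple of 4 the entries are all even or all odd, so the
  parity conditions of \<open>reps_double\<close> hold automatically.\<close>

lemma r4_four_times: "r4 (4 * n) = r4 (2 * n)"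
proof -
  have "r4 (2 * n) = reps (2 * int (2 * n)) (\<lambda>a b c d. even (a + b) \<and> even (c + d) \<and> True)"
    unfolding r4_eq_reps by (rule reps_double)
  also have "\<dots> = reps (int (4 * n)) (\<lambda>a b c d. even (a + b) \<and> even (c + d) \<and> True)"
    by simp
  also have "\<dots> = r4 (4 * n)"
    unfolding r4_eq_reps
  proof (rule reps_cong, goal_cases)
    case (1 a b c d)
    have "int (4 * n) mod 4 = 0"
      by simp
    then have "(a mod 2 + b mod 2 + c mod 2 + d mod 2) mod 4 = 0"
      using 1 sum_squares_mod_4[of a b c d] by simp
    then show ?case
      by (cases "even a"; cases "even b"; cases "even c"; cases "even d"; simp add: mod_2_eq_odd)
  qed
  finally show ?thesis ..
qed

text \<open>Exactly two entries are odd, so \<open>a\<close> shares its parity with exactly one of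
  \<open>b\<close>, \<open>c\<close>, \<open>d\<close>, and the three cases are equinumerous. The
  two cases with \<open>a + b\<close> odd, where \<open>c + d\<close> is odd too, correspond under
  \<open>reps_double\<close> to the representations of \<open>4 * m\<close> by odd squares. Hence
  \<open>r4 (2 * m)\<close> is 3/2 of \<open>16 * odd_divisor_sum m\<close>.\<close>

lemma r4_double_odd:
  assumes m: "odd m"
  shows "r4 (2 * m) = 24 * odd_divisor_sum m"
proof -
  define n where "n = 2 * int m"
  \<comment> \<open>Squares are 0 or 1 modulo 4, so the number of odd entries is 2 modulo 4; among 0
    to 4 only 2 remains.\<close>
  have parity: "a mod 2 + b mod 2 + c mod 2 + d mod 2 = 2" if "a\<^sup>2 + b\<^sup>2 + c\<^sup>2 + d\<^sup>2 = n" for a b c d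
  proof -
    have "n mod 4 = 2"
      using m unfolding n_def by presburger
    then have "(a mod 2 + b mod 2 + c mod 2 + d mod 2) mod 4 = 2"
      using that sum_squares_mod_4[of a b c d] by simp
    then show ?thesis
      by (cases "even a"; cases "even b"; cases "even c"; cases "even d"; simp add: mod_2_eq_odd)
  qed
  have "odd_reps (2 * n) = reps n (\<lambda>a b c d. odd (a + b) \<and> odd (a - b) \<and> odd (c + d) \<and> odd (c - d))"
    unfolding odd_reps_def reps_double[where P = "\<lambda>a b c d. odd a \<and> odd b \<and> odd c \<and> odd d"]
    by (rule reps_cong) auto
  also have "\<dots> = reps n (\<lambda>a b c d. True \<and> \<not> even (a + b))"
  proof (rule reps_cong, goal_cases)
    case (1 a b c d)
    then show ?case
      using parity[of a b c d]
      by (cases "even a"; cases "even b"; cases "even c"; cases "even d"; simp add: mod_2_eq_odd)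
  qed
  finally have odd12: "odd_reps (2 * n) = reps n (\<lambda>a b c d. True \<and> \<not> even (a + b))" .
  have "reps n (\<lambda>a b c d. True \<and> \<not> even (a + b))
      = reps n (\<lambda>a b c d. (True \<and> \<not> even (a + b)) \<and> even (a + c))
      + reps n (\<lambda>a b c d. (True \<and> \<not> even (a + b)) \<and> \<not> even (a + c))"
    by (rule reps_split)
  also have "reps n (\<lambda>a b c d. (True \<and> \<not> even (a + b)) \<and> even (a + c)) = reps n (\<lambda>a b c d. even (a + c))"
  proof (rule reps_cong, goal_cases)
    case (1 a b c d)
    then show ?case
      using parity[of a b c d]
      by (cases "even a"; cases "even b"; cases "even c"; cases "even d"; simp add: mod_2_eq_odd)
  qed
  also have "reps n (\<lambda>a b c d. (True \<and> \<not> even (a + b)) \<and> \<not> even (a + c)) = reps n (\<lambda>a b c d. even (a + d))"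
  proof (rule reps_cong, goal_cases)
    case (1 a b c d)
    then show ?case
      using parity[of a b c d]
      by (cases "even a"; cases "even b"; cases "even c"; cases "even d"; simp add: mod_2_eq_odd)
  qed
  also have "reps n (\<lambda>a b c d. even (a + d)) = reps n (\<lambda>a b c d. even (a + c))"
    by (rule reps_swap34)
  also have "reps n (\<lambda>a b c d. even (a + c)) = reps n (\<lambda>a b c d. even (a + b))"
    by (rule reps_swap23)
  finally have "odd_reps (2 * n) = 2 * reps n (\<lambda>a b c d. even (a + b))"
    using odd12 by simp
  moreover have "r4 (2 * m) = reps n (\<lambda>a b c d. even (a + b)) + odd_reps (2 * n)"
    using reps_split[of n "\<lambda>_ _ _ _. True" "\<lambda>a b c d. even (a + b)"] odd12
    by (simp add: r4_eq_reps n_def)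
  ultimately have "2 * r4 (2 * m) = 3 * odd_reps (2 * n)"
    by simp
  moreover have "int (odd_reps (2 * n)) = 16 * int (odd_divisor_sum m)"
  proof -
    have "(2 * n) mod 8 = 4"
      using m unfolding n_def by presburger
    then show ?thesis
      using odd_reps_eq_sigma4[of "2 * n"] sigma4_eq_odd_divisor_sum[OF m] by (simp add: n_def)
  qed
  ultimately show ?thesis
    by simp
qed

text \<open>Halving multiples of 4 changes neither side and ends at twice an odd number.\<close>

theorem r4_even:
  assumes "even n" "n > 0"
  shows "r4 n = 24 * odd_divisor_sum n"
  using assms
proof (induction n rule: less_induct)
  case (less n)
  then obtain m where n: "n = 2 * m"
    by (auto elim: evenE)
  show ?case
  proof (cases "even m")
    case True
    then obtain k where "m = 2 * k"
      by (auto elim: evenE)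
    with n have k: "n = 4 * k"
      by simp
    have "r4 n = r4 (2 * k)"
      unfolding k by (rule r4_four_times)
    also have "\<dots> = 24 * odd_divisor_sum (2 * k)"
      by (rule less.IH) (use k less.prems in auto)
    also have "odd_divisor_sum (2 * k) = odd_divisor_sum n"
      using odd_divisor_sum_double[of "2 * k"] by (simp add: k)
    finally show ?thesis .
  next
    case False
    then show ?thesis
      by (simp add: n r4_double_odd odd_divisor_sum_double)
  qed
qed

section \<open>Representations with prescribed residues\<close>

lemma square_mod_8: "x\<^sup>2 mod 8 = (if 4 dvd x then 0 else if odd x then 1 else (4::int))"
proof -
  have "even x" if "4 dvd x"
    using that by presburger
  then show ?thesis
    by (auto simp: odd_square_mod_8 even_square_mod_8)
qed

text \<open>One entry is divisible by 4, one is 2 modulo 4 and two are odd. The factor 48 consists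
  of 4 positions for the first, 3 for the second, and 2 signs for each odd entry, negation
  exchanging the residues 1 and 3.\<close>

lemma reps_residues_mod_4:
  assumes n: "n mod 8 = 6"
  shows "reps n (\<lambda>_ _ _ _. True)
    = 48 * reps n (\<lambda>a b c d. a mod 4 = 0 \<and> b mod 4 = 1 \<and> c mod 4 = 2 \<and> d mod 4 = 3)"
proof -
  \<comment> \<open>The sum is 6 as an integer and not only modulo 8, since 14 is not a sum of four
    values from 0, 1, 4. The only way to reach 6 is \<open>4 + 1 + 1 + 0\<close>.\<close>
  have residues: "(if 4 dvd a then 0 else if odd a then 1 else 4) + (if 4 dvd b then 0 else if odd b then 1 else 4)
      + (if 4 dvd c then 0 else if odd c then 1 else 4) + (if 4 dvd d then 0 else if odd d then 1 else 4) = (6::int)"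
    if "a\<^sup>2 + b\<^sup>2 + c\<^sup>2 + d\<^sup>2 = n" for a b c d :: int
  proof -
    have "(a\<^sup>2 mod 8 + b\<^sup>2 mod 8 + c\<^sup>2 mod 8 + d\<^sup>2 mod 8) mod 8
        = (a\<^sup>2 + b\<^sup>2 + c\<^sup>2 + d\<^sup>2) mod 8"
      by (intro mod_add_cong) simp_all
    also have "\<dots> = 6"
      using n that by simp
    finally show ?thesis
      unfolding square_mod_8
      by (cases "4 dvd a"; cases "odd a"; cases "4 dvd b"; cases "odd b"; cases "4 dvd c"; cases "odd c";
          cases "4 dvd d"; cases "odd d"; simp)
  qed
  let ?Z = "\<lambda>x::int. 4 dvd x" and ?H = "\<lambda>x::int. even x \<and> \<not> 4 dvd x"
  have "reps n (\<lambda>_ _ _ _. True) = reps n (\<lambda>a b c d. ?Z a) + reps n (\<lambda>a b c d. \<not> ?Z a)"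
    using reps_split[of n "\<lambda>_ _ _ _. True" "\<lambda>a b c d. ?Z a"] by simp
  also have "reps n (\<lambda>a b c d. \<not> ?Z a)
      = reps n (\<lambda>a b c d. \<not> ?Z a \<and> ?Z b) + reps n (\<lambda>a b c d. \<not> ?Z a \<and> \<not> ?Z b)"
    by (rule reps_split)
  also have "reps n (\<lambda>a b c d. \<not> ?Z a \<and> \<not> ?Z b)
      = reps n (\<lambda>a b c d. (\<not> ?Z a \<and> \<not> ?Z b) \<and> ?Z c) + reps n (\<lambda>a b c d. (\<not> ?Z a \<and> \<not> ?Z b) \<and> \<not> ?Z c)"
    by (rule reps_split)
  also have "reps n (\<lambda>a b c d. \<not> ?Z a \<and> ?Z b) = reps n (\<lambda>a b c d. ?Z b)"
    by (rule reps_cong) (drule residues, auto split: if_splits)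
  also have "reps n (\<lambda>a b c d. (\<not> ?Z a \<and> \<not> ?Z b) \<and> ?Z c) = reps n (\<lambda>a b c d. ?Z c)"
    by (rule reps_cong) (drule residues, auto split: if_splits)
  also have "reps n (\<lambda>a b c d. (\<not> ?Z a \<and> \<not> ?Z b) \<and> \<not> ?Z c) = reps n (\<lambda>a b c d. ?Z d)"
    by (rule reps_cong) (drule residues, auto split: if_splits)
  also have "reps n (\<lambda>a b c d. ?Z d) = reps n (\<lambda>a b c d. ?Z c)"
    by (rule reps_swap34)
  also have "reps n (\<lambda>a b c d. ?Z c) = reps n (\<lambda>a b c d. ?Z b)"
    by (rule reps_swap23)
  also have "reps n (\<lambda>a b c d. ?Z b) = reps n (\<lambda>a b c d. ?Z a)"
    by (rule reps_swap12)
  finally have 1: "reps n (\<lambda>_ _ _ _. True) = 4 * reps n (\<lambda>a b c d. ?Z a)"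
    by simp
  have "reps n (\<lambda>a b c d. ?Z a) = reps n (\<lambda>a b c d. ?Z a \<and> ?H b) + reps n (\<lambda>a b c d. ?Z a \<and> \<not> ?H b)"
    by (rule reps_split)
  also have "reps n (\<lambda>a b c d. ?Z a \<and> \<not> ?H b)
      = reps n (\<lambda>a b c d. (?Z a \<and> \<not> ?H b) \<and> ?H c) + reps n (\<lambda>a b c d. (?Z a \<and> \<not> ?H b) \<and> \<not> ?H c)"
    by (rule reps_split)
  also have "reps n (\<lambda>a b c d. (?Z a \<and> \<not> ?H b) \<and> ?H c) = reps n (\<lambda>a b c d. ?Z a \<and> ?H c)"
    by (rule reps_cong) (drule residues, auto split: if_splits)
  also have "reps n (\<lambda>a b c d. (?Z a \<and> \<not> ?H b) \<and> \<not> ?H c) = reps n (\<lambda>a b c d. ?Z a \<and> ?H d)"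
    by (rule reps_cong) (drule residues, auto split: if_splits)
  also have "reps n (\<lambda>a b c d. ?Z a \<and> ?H d) = reps n (\<lambda>a b c d. ?Z a \<and> ?H c)"
    by (rule reps_swap34)
  also have "reps n (\<lambda>a b c d. ?Z a \<and> ?H b) = reps n (\<lambda>a b c d. ?Z a \<and> ?H c)"
    by (rule reps_swap23)
  finally have 2: "reps n (\<lambda>a b c d. ?Z a) = 3 * reps n (\<lambda>a b c d. ?Z a \<and> ?H c)"
    by simp
  have "reps n (\<lambda>a b c d. ?Z a \<and> ?H c)
      = reps n (\<lambda>a b c d. (?Z a \<and> ?H c) \<and> b mod 4 = 1) + reps n (\<lambda>a b c d. (?Z a \<and> ?H c) \<and> \<not> b mod 4 = 1)"
    by (rule reps_split)
  also have "reps n (\<lambda>a b c d. (?Z a \<and> ?H c) \<and> \<not> b mod 4 = 1)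
      = reps n (\<lambda>a b c d. (?Z a \<and> ?H c) \<and> (-b) mod 4 = 1)"
  proof (rule reps_cong, rule conj_cong[OF refl], goal_cases)
    case (1 a b c d)
    then have "odd b"
      using residues[of a b c d] by (auto split: if_splits)
    then have "b mod 4 = 1 \<or> b mod 4 = 3"
      by presburger
    then show ?case
      by (auto simp: zmod_zminus1_eq_if)
  qed
  also have "\<dots> = reps n (\<lambda>a b c d. (?Z a \<and> ?H c) \<and> b mod 4 = 1)"
    by (rule reps_minus2[symmetric])
  finally have 3: "reps n (\<lambda>a b c d. ?Z a \<and> ?H c) = 2 * reps n (\<lambda>a b c d. (?Z a \<and> ?H c) \<and> b mod 4 = 1)"
    by simp
  let ?Q = "\<lambda>a b c. ((?Z a \<and> ?H c) \<and> b mod 4 = 1)"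
  have "reps n (\<lambda>a b c d. ?Q a b c)
      = reps n (\<lambda>a b c d. ?Q a b c \<and> d mod 4 = 3) + reps n (\<lambda>a b c d. ?Q a b c \<and> \<not> d mod 4 = 3)"
    by (rule reps_split)
  also have "reps n (\<lambda>a b c d. ?Q a b c \<and> \<not> d mod 4 = 3) = reps n (\<lambda>a b c d. ?Q a b c \<and> (-d) mod 4 = 3)"
  proof (rule reps_cong, rule conj_cong[OF refl], goal_cases)
    case (1 a b c d)
    then have "odd d"
      using residues[of a b c d] by (auto split: if_splits)
    then have "d mod 4 = 1 \<or> d mod 4 = 3"
      by presburger
    then show ?case
      by (auto simp: zmod_zminus1_eq_if)
  qed
  also have "\<dots> = reps n (\<lambda>a b c d. ?Q a b c \<and> d mod 4 = 3)"
    by (rule reps_minus4[symmetric])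
  finally have 4: "reps n (\<lambda>a b c d. ?Q a b c) = 2 * reps n (\<lambda>a b c d. ?Q a b c \<and> d mod 4 = 3)"
    by simp
  have "reps n (\<lambda>a b c d. ?Q a b c \<and> d mod 4 = 3)
      = reps n (\<lambda>a b c d. a mod 4 = 0 \<and> b mod 4 = 1 \<and> c mod 4 = 2 \<and> d mod 4 = 3)"
  proof (rule reps_cong, goal_cases)
    case (1 a b c d)
    have "4 dvd a \<longleftrightarrow> a mod 4 = 0" "even c \<and> \<not> 4 dvd c \<longleftrightarrow> c mod 4 = 2"
      by presburger+
    then show ?case
      by blast
  qed
  then show ?thesis
    using 1 2 3 4 by simp
qed

section \<open>Residues modulo 3\<close>

lemma square_mod_3: "x\<^sup>2 mod 3 = (if 3 dvd x then 0 else (1::int))"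
proof -
  consider k where "x = 3 * k" | k where "x = 3 * k + 1" | k where "x = 3 * k + 2"
    by atomize_elim presburger
  then show ?thesis
  proof cases
    case (1 k)
    then show ?thesis
      by (simp add: power2_eq_square)
  next
    case (2 k)
    then have "x\<^sup>2 = 3 * (3 * k\<^sup>2 + 2 * k) + 1"
      by (simp add: power2_eq_square algebra_simps)
    moreover have "\<not> 3 dvd x"
      using 2 by presburger
    ultimately show ?thesis
      by presburger
  next
    case (3 k)
    then have "x\<^sup>2 = 3 * (3 * k\<^sup>2 + 4 * k + 1) + 1"
      by (simp add: power2_eq_square algebra_simps)
    moreover have "\<not> 3 dvd x"
      using 3 by presburger
    ultimately show ?thesis
      by presburger
  qed
qed

text \<open>Exactly two entries are divisible by 3. There are 6 choices for their positions and 2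
  signs for each of the other entries, negation exchanging the residues 1 and 2.\<close>

lemma reps_residues_mod_3:
  assumes n: "n mod 3 = 2"
  shows "reps n (\<lambda>_ _ _ _. True)
    = 24 * reps n (\<lambda>a b c d. a mod 3 = 0 \<and> b mod 3 = 1 \<and> c mod 3 = 2 \<and> d mod 3 = 0)"
proof -
  have residues: "(if 3 dvd a then 0 else 1) + (if 3 dvd b then 0 else 1)
      + (if 3 dvd c then 0 else 1) + (if 3 dvd d then 0 else 1) = (2::int)"
    if "a\<^sup>2 + b\<^sup>2 + c\<^sup>2 + d\<^sup>2 = n" for a b c d :: int
  proof -
    have "(a\<^sup>2 mod 3 + b\<^sup>2 mod 3 + c\<^sup>2 mod 3 + d\<^sup>2 mod 3) mod 3
        = (a\<^sup>2 + b\<^sup>2 + c\<^sup>2 + d\<^sup>2) mod 3"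
      by (intro mod_add_cong) simp_all
    also have "\<dots> = 2"
      using n that by simp
    finally show ?thesis
      unfolding square_mod_3 by (auto split: if_splits)
  qed
  let ?Z = "\<lambda>x::int. 3 dvd x"
  have "reps n (\<lambda>_ _ _ _. True) = reps n (\<lambda>a b c d. ?Z a) + reps n (\<lambda>a b c d. \<not> ?Z a)"
    using reps_split[of n "\<lambda>_ _ _ _. True" "\<lambda>a b c d. ?Z a"] by simp
  also have "reps n (\<lambda>a b c d. ?Z a)
      = reps n (\<lambda>a b c d. ?Z a \<and> ?Z b) + reps n (\<lambda>a b c d. ?Z a \<and> \<not> ?Z b)"
    by (rule reps_split)
  also have "reps n (\<lambda>a b c d. ?Z a \<and> \<not> ?Z b)
      = reps n (\<lambda>a b c d. (?Z a \<and> \<not> ?Z b) \<and> ?Z c) + reps n (\<lambda>a b c d. (?Z a \<and> \<not> ?Z b) \<and> \<not> ?Z c)"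
    by (rule reps_split)
  also have "reps n (\<lambda>a b c d. (?Z a \<and> \<not> ?Z b) \<and> ?Z c) = reps n (\<lambda>a b c d. ?Z a \<and> ?Z c)"
    by (rule reps_cong) (drule residues, auto split: if_splits)
  also have "reps n (\<lambda>a b c d. (?Z a \<and> \<not> ?Z b) \<and> \<not> ?Z c) = reps n (\<lambda>a b c d. ?Z a \<and> ?Z d)"
    by (rule reps_cong) (drule residues, auto split: if_splits)
  also have "reps n (\<lambda>a b c d. \<not> ?Z a)
      = reps n (\<lambda>a b c d. \<not> ?Z a \<and> ?Z b) + reps n (\<lambda>a b c d. \<not> ?Z a \<and> \<not> ?Z b)"
    by (rule reps_split)
  also have "reps n (\<lambda>a b c d. \<not> ?Z a \<and> \<not> ?Z b) = reps n (\<lambda>a b c d. ?Z c \<and> ?Z d)"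
    by (rule reps_cong) (drule residues, auto split: if_splits)
  also have "reps n (\<lambda>a b c d. \<not> ?Z a \<and> ?Z b)
      = reps n (\<lambda>a b c d. (\<not> ?Z a \<and> ?Z b) \<and> ?Z c) + reps n (\<lambda>a b c d. (\<not> ?Z a \<and> ?Z b) \<and> \<not> ?Z c)"
    by (rule reps_split)
  also have "reps n (\<lambda>a b c d. (\<not> ?Z a \<and> ?Z b) \<and> ?Z c) = reps n (\<lambda>a b c d. ?Z b \<and> ?Z c)"
    by (rule reps_cong) (drule residues, auto split: if_splits)
  also have "reps n (\<lambda>a b c d. (\<not> ?Z a \<and> ?Z b) \<and> \<not> ?Z c) = reps n (\<lambda>a b c d. ?Z b \<and> ?Z d)"
    by (rule reps_cong) (drule residues, auto split: if_splits)
  also have "reps n (\<lambda>a b c d. ?Z b \<and> ?Z c) = reps n (\<lambda>a b c d. ?Z b \<and> ?Z d)"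
    by (rule reps_swap34)
  also have "reps n (\<lambda>a b c d. ?Z c \<and> ?Z d) = reps n (\<lambda>a b c d. ?Z b \<and> ?Z d)"
    by (rule reps_swap23)
  also have "reps n (\<lambda>a b c d. ?Z b \<and> ?Z d) = reps n (\<lambda>a b c d. ?Z a \<and> ?Z d)"
    by (rule reps_swap12)
  also have "reps n (\<lambda>a b c d. ?Z a \<and> ?Z b) = reps n (\<lambda>a b c d. ?Z a \<and> ?Z c)"
    by (rule reps_swap23)
  also have "reps n (\<lambda>a b c d. ?Z a \<and> ?Z c) = reps n (\<lambda>a b c d. ?Z a \<and> ?Z d)"
    by (rule reps_swap34)
  finally have 1: "reps n (\<lambda>_ _ _ _. True) = 6 * reps n (\<lambda>a b c d. ?Z a \<and> ?Z d)"
    by simp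
  have "reps n (\<lambda>a b c d. ?Z a \<and> ?Z d)
      = reps n (\<lambda>a b c d. (?Z a \<and> ?Z d) \<and> b mod 3 = 1) + reps n (\<lambda>a b c d. (?Z a \<and> ?Z d) \<and> \<not> b mod 3 = 1)"
    by (rule reps_split)
  also have "reps n (\<lambda>a b c d. (?Z a \<and> ?Z d) \<and> \<not> b mod 3 = 1)
      = reps n (\<lambda>a b c d. (?Z a \<and> ?Z d) \<and> (-b) mod 3 = 1)"
  proof (rule reps_cong, rule conj_cong[OF refl], goal_cases)
    case (1 a b c d)
    then have "\<not> 3 dvd b"
      using residues[of a b c d] by (auto split: if_splits)
    then show ?case
      by presburger
  qed
  also have "\<dots> = reps n (\<lambda>a b c d. (?Z a \<and> ?Z d) \<and> b mod 3 = 1)"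
    by (rule reps_minus2[symmetric])
  finally have 2: "reps n (\<lambda>a b c d. ?Z a \<and> ?Z d) = 2 * reps n (\<lambda>a b c d. (?Z a \<and> ?Z d) \<and> b mod 3 = 1)"
    by simp
  let ?Q = "\<lambda>a b d. ((?Z a \<and> ?Z d) \<and> b mod 3 = 1)"
  have "reps n (\<lambda>a b c d. ?Q a b d)
      = reps n (\<lambda>a b c d. ?Q a b d \<and> c mod 3 = 2) + reps n (\<lambda>a b c d. ?Q a b d \<and> \<not> c mod 3 = 2)"
    by (rule reps_split)
  also have "reps n (\<lambda>a b c d. ?Q a b d \<and> \<not> c mod 3 = 2) = reps n (\<lambda>a b c d. ?Q a b d \<and> (-c) mod 3 = 2)"
  proof (rule reps_cong, rule conj_cong[OF refl], goal_cases)
    case (1 a b c d)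
    then have "\<not> 3 dvd c"
      using residues[of a b c d] by (auto split: if_splits)
    then show ?case
      by presburger
  qed
  also have "\<dots> = reps n (\<lambda>a b c d. ?Q a b d \<and> c mod 3 = 2)"
    by (rule reps_minus3[symmetric])
  finally have 3: "reps n (\<lambda>a b c d. ?Q a b d) = 2 * reps n (\<lambda>a b c d. ?Q a b d \<and> c mod 3 = 2)"
    by simp
  have "reps n (\<lambda>a b c d. ?Q a b d \<and> c mod 3 = 2)
      = reps n (\<lambda>a b c d. a mod 3 = 0 \<and> b mod 3 = 1 \<and> c mod 3 = 2 \<and> d mod 3 = 0)"
    unfolding dvd_eq_mod_eq_0 by (rule reps_cong) blast
  then show ?thesis
    using 1 2 3 by simp
qed

section \<open>The orbit of the second fundamental weight\<close>

text \<open>In the standard coordinates of the finite root system, an element of the orbit of \<open>\<Lambda>\<^sub>2\<close> is determined by its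
  finite part, a vector \<open>v\<close> with exactly two odd entries; the invariant form fixes its coefficient
  \<open>-n\<close> of \<open>\<delta>\<close>, where \<open>4 * n = \<parallel>v\<parallel>\<^sup>2 - 2\<close>.\<close>

definition two_odd :: "(int \<times> int \<times> int \<times> int) set" where
  "two_odd = {(a, b, c, d). a mod 2 + b mod 2 + c mod 2 + d mod 2 = 2}"

text \<open>The coordinates of \<open>(1, 1, 0, 0) - v + n * \<delta>\<close> in the simple roots.
  The multiples of \<open>n\<close> are the marks of \<delta>, namely 1, 1, 2, 2, 2 and 1, 1, 2, 1,
  1; the rest expands the finite part in the simple roots of the finite system.\<close>

fun root_coeff :: "affine_type \<Rightarrow> nat \<Rightarrow> int \<times> int \<times> int \<times> int \<Rightarrow> real" where
  "root_coeff B4_1 i (a, b, c, d) =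
    (let n = (a\<^sup>2 + b\<^sup>2 + c\<^sup>2 + d\<^sup>2 - 2) / 4
     in [n, 1 - a + n, 2 - a - b + 2 * n, 2 - a - b - c + 2 * n, 2 - a - b - c - d + 2 * n] ! i)"
| "root_coeff D4_1 i (a, b, c, d) =
    (let n = (a\<^sup>2 + b\<^sup>2 + c\<^sup>2 + d\<^sup>2 - 2) / 4
     in [n, 1 - a + n, 2 - a - b + 2 * n, (2 - a - b - c + d) / 2 + n, (2 - a - b - c - d) / 2 + n] ! i)"

text \<open>The coroots in standard coordinates. The constant 2 at node 0 is the level of
  \<open>\<Lambda> 2\<close>.\<close>

fun pairing :: "affine_type \<Rightarrow> nat \<Rightarrow> int \<times> int \<times> int \<times> int \<Rightarrow> int" where
  "pairing B4_1 i (a, b, c, d) = [2 - a - b, a - b, b - c, c - d, 2 * d] ! i"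
| "pairing D4_1 i (a, b, c, d) = [2 - a - b, a - b, b - c, c - d, c + d] ! i"

text \<open>The action on finite parts: node 0 is the affine reflection in the hyperplane
  \<open>a + b = 2\<close>, the other nodes are linear.\<close>

fun reflect :: "affine_type \<Rightarrow> nat \<Rightarrow> int \<times> int \<times> int \<times> int \<Rightarrow> int \<times> int \<times> int \<times> int" where
  "reflect B4_1 i (a, b, c, d) =
    [(2 - b, 2 - a, c, d), (b, a, c, d), (a, c, b, d), (a, b, d, c), (a, b, c, -d)] ! i"
| "reflect D4_1 i (a, b, c, d) =
    [(2 - b, 2 - a, c, d), (b, a, c, d), (a, c, b, d), (a, b, d, c), (a, b, -d, -c)] ! i"

text \<open>Completing the square in the height: \<open>\<parallel>4 v - \<rho>\<parallel>\<^sup>2\<close> with \<open>\<rho> = (4, 3, 2, 1)\<close> for \<open>B\<^sub>4\<close>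
  and \<open>\<parallel>3 v - \<rho>\<parallel>\<^sup>2\<close> with \<open>\<rho> = (3, 2, 1, 0)\<close> for \<open>D\<^sub>4\<close>.\<close>

fun shifted_norm :: "affine_type \<Rightarrow> int \<times> int \<times> int \<times> int \<Rightarrow> int" where
  "shifted_norm B4_1 (a, b, c, d) = (4 * a - 4)\<^sup>2 + (4 * b - 3)\<^sup>2 + (4 * c - 2)\<^sup>2 + (4 * d - 1)\<^sup>2"
| "shifted_norm D4_1 (a, b, c, d) = (3 * a - 3)\<^sup>2 + (3 * b - 2)\<^sup>2 + (3 * c - 1)\<^sup>2 + (3 * d)\<^sup>2"

fun height_norm :: "affine_type \<Rightarrow> int \<Rightarrow> int" where
  "height_norm B4_1 N = 8 * N + 6"
| "height_norm D4_1 N = 6 * N + 2"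

lemma node_cases: "(i::nat) \<le> 4 \<Longrightarrow> i = 0 \<or> i = 1 \<or> i = 2 \<or> i = 3 \<or> i = 4"
  by linarith

lemma reflect_two_odd:
  assumes "v \<in> two_odd" "i \<le> 4"
  shows "reflect X i v \<in> two_odd"
proof -
  have "(2 - x) mod 2 = x mod 2" "(- x) mod 2 = x mod 2" for x :: int
    by presburger+
  then show ?thesis
    using assms(1) node_cases[OF assms(2)]
    by (cases v; cases X) (auto simp: two_odd_def)
qed

lemma root_coeff_reflect:
  assumes "i \<le> 4" "k \<le> 4"
  shows "root_coeff X k (reflect X i v) = root_coeff X k v + (if k = i then of_int (pairing X i v) else 0)"
  using node_cases[OF assms(1)] node_cases[OF assms(2)]
  by (cases v; cases X) (elim disjE; simp add: Let_def power2_eq_square field_simps)+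

text \<open>A reflection changes the height by the pairing, and the shifted norm is an affine
  function of the height with slope 8 or 6. Reflecting at a negative pairing thus lowers it.\<close>

lemma shifted_norm_reflect:
  assumes "i \<le> 4"
  shows "shifted_norm X (reflect X i v) = shifted_norm X v + (case X of B4_1 \<Rightarrow> 8 | D4_1 \<Rightarrow> 6) * pairing X i v"
  using node_cases[OF assms]
  by (cases v; cases X) (elim disjE; simp add: power2_eq_square algebra_simps)+

lemma shifted_norm_nonneg: "0 \<le> shifted_norm X v"
  by (cases v; cases X) auto

lemma shifted_norm_eq_height:
  "of_int (shifted_norm X v) = (case X of B4_1 \<Rightarrow> 8 * (\<Sum>i\<le>4. root_coeff X i v) + 6
    | D4_1 \<Rightarrow> 6 * (\<Sum>i\<le>4. root_coeff X i v) + 2)"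
  by (cases v; cases X) (simp_all add: nodes_eq Let_def power2_eq_square field_simps)

text \<open>Dominance confines \<open>v\<close> to a closed alcove, where \<open>b\<close> is 0 or
  1. If \<open>b = 0\<close>, at most \<open>a\<close> is odd; if \<open>b = c = 1\<close>, then
  \<open>a = 1\<close> and at least three entries are odd.\<close>

lemma dominant_two_odd:
  assumes "v \<in> two_odd" and dom: "\<And>i. i \<le> 4 \<Longrightarrow> 0 \<le> pairing X i v"
  shows "v = (1, 1, 0, 0)"
proof -
  obtain a b c d where v: "v = (a, b, c, d)"
    by (cases v)
  have odds: "a mod 2 + b mod 2 + c mod 2 + d mod 2 = 2"
    using assms(1) by (simp add: v two_odd_def)
  \<comment> \<open>Node 4 gives \<open>0 \<le> d\<close> in type B and \<open>0 \<le> c + d\<close>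
    in type D; the latter follows in both and suffices.\<close>
  have ineqs: "a + b \<le> 2" "b \<le> a" "c \<le> b" "d \<le> c" "0 \<le> c + d"
    using dom[of 0] dom[of 1] dom[of 2] dom[of 3] dom[of 4]
    by (cases X; simp add: v)+
  then have "b = 0 \<and> c = 0 \<and> d = 0 \<or> b = 1 \<and> a = 1 \<and> c = 0 \<and> d = 0 \<or> b = 1 \<and> a = 1 \<and> c = 1"
    by linarith
  then show ?thesis
  proof (elim disjE)
    assume "b = 0 \<and> c = 0 \<and> d = 0"
    then have "a mod 2 = 2"
      using odds by simp
    then have False
      by presburger
    then show ?thesis ..
  next
    assume "b = 1 \<and> a = 1 \<and> c = 1"
    then have "d mod 2 = - 1"
      using odds by simp
    then have False
      by presburger
    then show ?thesis ..
  qed (simp add: v)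
qed

lemma root_coeff_inj:
  assumes eq: "\<And>i. i \<le> 4 \<Longrightarrow> root_coeff X i v = root_coeff X i w"
  shows "v = w"
proof -
  obtain a b c d where v: "v = (a, b, c, d)"
    by (cases v)
  obtain a' b' c' d' where w: "w = (a', b', c', d')"
    by (cases w)
  define n n' :: real where "n = (a\<^sup>2 + b\<^sup>2 + c\<^sup>2 + d\<^sup>2 - 2) / 4"
    and "n' = (a'\<^sup>2 + b'\<^sup>2 + c'\<^sup>2 + d'\<^sup>2 - 2) / 4"
  have n: "root_coeff X 0 v = n" "root_coeff X 0 w = n'"
    by (cases X; simp add: v w n_def n'_def Let_def)+
  then have "n = n'"
    using eq[of 0] by simp
  moreover have "root_coeff X 1 v = 1 - a + n" "root_coeff X 1 w = 1 - a' + n'"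
    "root_coeff X 2 v = 2 - a - b + 2 * n" "root_coeff X 2 w = 2 - a' - b' + 2 * n'"
    by (cases X; simp add: v w n_def n'_def Let_def)+
  ultimately have ab: "a = a'" "b = b'"
    using eq[of 1] eq[of 2] by simp_all
  have "c = c' \<and> d = d'"
  proof (cases X)
    case B4_1
    then have "root_coeff X 3 v = 2 - a - b - c + 2 * n" "root_coeff X 3 w = 2 - a' - b' - c' + 2 * n'"
      "root_coeff X 4 v = 2 - a - b - c - d + 2 * n" "root_coeff X 4 w = 2 - a' - b' - c' - d' + 2 * n'"
      by (simp_all add: v w n_def n'_def Let_def)
    then show ?thesis
      using eq[of 3] eq[of 4] \<open>n = n'\<close> ab by simp
  next
    case D4_1
    then have "root_coeff X 3 v = (2 - a - b - c + d) / 2 + n" "root_coeff X 3 w = (2 - a' - b' - c' + d') / 2 + n'"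
      "root_coeff X 4 v = (2 - a - b - c - d) / 2 + n" "root_coeff X 4 w = (2 - a' - b' - c' - d') / 2 + n'"
      by (simp_all add: v w n_def n'_def Let_def)
    then show ?thesis
      using eq[of 3] eq[of 4] \<open>n = n'\<close> ab by simp
  qed
  with ab show ?thesis
    by (simp add: v w)
qed

section \<open>Orbit weights inside a realization\<close>

context realization
begin

definition weight :: "int \<times> int \<times> int \<times> int \<Rightarrow> 'v" where
  "weight v = \<Lambda> 2 - (\<Sum>i\<le>4. root_coeff X i v *\<^sub>R \<alpha> i)"

lemma weight_base: "weight (1, 1, 0, 0) = \<Lambda> 2"
proof -
  have "root_coeff X i (1, 1, 0, 0) = 0" if "i \<le> 4" for i
    using node_cases[OF that] by (cases X) auto
  then show ?thesis
    by (simp add: weight_def)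
qed

text \<open>The marks of \<delta> form a null vector of the Cartan matrix, so the quadratic term
  \<open>n\<close> cancels and only the finite part and \<open>\<Lambda> 2\<close>
  contribute.\<close>

lemma coroot_weight:
  assumes "i \<le> 4"
  shows "coroot i (weight v) = of_int (pairing X i v)"
proof -
  interpret linear "coroot i"
    using assms by (rule linear_coroot)
  have "coroot i (weight v) = (if 2 = i then 1 else 0) - (\<Sum>k\<le>4. root_coeff X k v * of_int (cartan X i k))"
    using assms by (simp add: weight_def diff sum scale coroot_root coroot_fundamental)
  also have "\<dots> = of_int (pairing X i v)"
    using node_cases[OF assms]
    by (cases v; cases X) (elim disjE; simp add: nodes_eq Let_def field_simps)+
  finally show ?thesis .
qed

lemma reflection_weight:
  assumes "i \<le> 4"
  shows "simple_reflection \<alpha> coroot i (weight v) = weight (reflect X i v)"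
proof -
  have "(\<Sum>k\<le>4. root_coeff X k (reflect X i v) *\<^sub>R \<alpha> k)
      = (\<Sum>k\<le>4. root_coeff X k v *\<^sub>R \<alpha> k + (if k = i then of_int (pairing X i v) *\<^sub>R \<alpha> k else 0))"
    by (rule sum.cong) (use assms in \<open>auto simp: root_coeff_reflect scaleR_add_left\<close>)
  also have "\<dots> = (\<Sum>k\<le>4. root_coeff X k v *\<^sub>R \<alpha> k) + of_int (pairing X i v) *\<^sub>R \<alpha> i"
    using assms by (simp add: sum.distrib)
  finally show ?thesis
    using coroot_weight[OF assms] by (simp add: simple_reflection_def weight_def)
qed

lemma representation_roots:
  assumes "k \<le> 4"
  shows "representation (\<alpha> ` {..4}) (\<Sum>i\<le>4. c i *\<^sub>R \<alpha> i) (\<alpha> k) = c k"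
proof -
  have span: "\<alpha> i \<in> span (\<alpha> ` {..4})" if "i \<le> 4" for i
    using that by (intro span_base) auto
  have "representation (\<alpha> ` {..4}) (\<Sum>i\<le>4. c i *\<^sub>R \<alpha> i) (\<alpha> k)
      = (\<Sum>i\<le>4. representation (\<alpha> ` {..4}) (c i *\<^sub>R \<alpha> i) (\<alpha> k))"
    using span by (subst real_vector.representation_sum[OF independent_roots]) (auto intro: span_scale)
  also have "\<dots> = (\<Sum>i\<le>4. if i = k then c i else 0)"
  proof (rule sum.cong)
    fix i :: nat
    assume "i \<in> {..4}"
    then have "representation (\<alpha> ` {..4}) (c i *\<^sub>R \<alpha> i) (\<alpha> k) = c i * (if \<alpha> k = \<alpha> i then 1 else 0)"
      using span by (simp add: real_vector.representation_scale[OF independent_roots]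
          real_vector.representation_basis[OF independent_roots])
    moreover have "\<alpha> k = \<alpha> i \<longleftrightarrow> i = k"
      using inj_root \<open>i \<in> {..4}\<close> assms by (auto simp: inj_on_def)
    ultimately show "representation (\<alpha> ` {..4}) (c i *\<^sub>R \<alpha> i) (\<alpha> k) = (if i = k then c i else 0)"
      by simp
  qed simp
  also have "\<dots> = c k"
    using assms by simp
  finally show ?thesis .
qed

lemma inj_weight: "inj weight"
proof (rule injI)
  fix v w
  assume "weight v = weight w"
  then have eq: "(\<Sum>i\<le>4. root_coeff X i v *\<^sub>R \<alpha> i) = (\<Sum>i\<le>4. root_coeff X i w *\<^sub>R \<alpha> i)"
    by (simp add: weight_def)
  show "v = w"
  proof (rule root_coeff_inj)
    show "root_coeff X i v = root_coeff X i w" if "i \<le> 4" for i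
      using representation_roots[OF that, of "\<lambda>i. root_coeff X i v"]
        representation_roots[OF that, of "\<lambda>i. root_coeff X i w"] eq by simp
  qed
qed

lemma ht_weight: "ht \<alpha> (\<Lambda> 2 - weight v) = (\<Sum>i\<le>4. root_coeff X i v)"
  by (simp add: ht_def weight_def representation_roots)

lemma ht_weight_iff: "ht \<alpha> (\<Lambda> 2 - weight v) = real N \<longleftrightarrow> shifted_norm X v = height_norm X (int N)"
proof -
  have "shifted_norm X v = height_norm X (int N)
      \<longleftrightarrow> real_of_int (shifted_norm X v) = of_int (height_norm X (int N))"
    by (simp only: of_int_eq_iff)
  then show ?thesis
    unfolding ht_weight shifted_norm_eq_height by (simp split: affine_type.split)
qed

section \<open>Orbits of the group generated by the reflections\<close>

lemma reflection_involution:
  assumes "i \<le> 4"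
  shows "simple_reflection \<alpha> coroot i (simple_reflection \<alpha> coroot i v) = v"
proof -
  interpret linear "coroot i"
    using assms by (rule linear_coroot)
  have "coroot i (\<alpha> i) = 2"
    using node_cases[OF assms] coroot_root[OF assms assms] by (cases X) auto
  then show ?thesis
    by (simp add: simple_reflection_def diff scale algebra_simps flip: scaleR_add_left)
qed

lemma weyl_group_carrier: "weyl_group \<alpha> coroot \<subseteq> carrier (BijGroup UNIV)"
  unfolding weyl_group_def
  by (rule group.generate_incl[OF group_BijGroup]) (use simple_reflection_in_BijGroup in auto)

lemma BijGroup_mult:
  assumes "f \<in> carrier (BijGroup UNIV)" "g \<in> carrier (BijGroup UNIV)"
  shows "(f \<otimes>\<^bsub>BijGroup UNIV\<^esub> g) v = f (g v)"
  using assms by (simp add: BijGroup_def compose_def)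

lemma reflection_self_inverse:
  assumes "i \<le> 4"
  shows "inv\<^bsub>BijGroup UNIV\<^esub> (simple_reflection \<alpha> coroot i) = simple_reflection \<alpha> coroot i"
proof -
  let ?s = "simple_reflection \<alpha> coroot i"
  have s: "?s \<in> carrier (BijGroup UNIV)"
    using assms by (rule simple_reflection_in_BijGroup)
  have "?s \<otimes>\<^bsub>BijGroup UNIV\<^esub> ?s = \<one>\<^bsub>BijGroup UNIV\<^esub>"
  proof
    fix v
    show "(?s \<otimes>\<^bsub>BijGroup UNIV\<^esub> ?s) v = \<one>\<^bsub>BijGroup UNIV\<^esub> v"
      using reflection_involution[OF assms] s by (simp add: BijGroup_mult) (simp add: BijGroup_def)
  qed
  then show ?thesis
    by (rule group.inv_equality[OF group_BijGroup]) (rule s)+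
qed

text \<open>Closure under the simple reflections is enough, because each generator is its own
  inverse in the group.\<close>

lemma weyl_orbit_subset:
  assumes "v \<in> S" and closed: "\<And>i u. i \<le> 4 \<Longrightarrow> u \<in> S \<Longrightarrow> simple_reflection \<alpha> coroot i u \<in> S"
  shows "weyl_orbit \<alpha> coroot v \<subseteq> S"
proof -
  have "\<forall>u\<in>S. w u \<in> S" if "w \<in> weyl_group \<alpha> coroot" for w
    using that unfolding weyl_group_def
  proof (induction rule: generate.induct)
    case one
    then show ?case
      by (simp add: BijGroup_def)
  next
    case (incl h)
    then show ?case
      using closed by auto
  next
    case (inv h)
    then show ?case
      using closed by (auto simp: reflection_self_inverse)
  next
    case (eng g h)
    then have "g \<in> carrier (BijGroup UNIV)" "h \<in> carrier (BijGroup UNIV)"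
      using weyl_group_carrier by (auto simp: weyl_group_def)
    then show ?case
      using eng.IH by (simp add: BijGroup_mult)
  qed
  then show ?thesis
    using assms(1) by (auto simp: weyl_orbit_def)
qed

lemma self_in_weyl_orbit: "v \<in> weyl_orbit \<alpha> coroot v"
proof -
  have "\<one>\<^bsub>BijGroup UNIV\<^esub> \<in> weyl_group \<alpha> coroot"
    unfolding weyl_group_def by (rule generate.one)
  moreover have "v = \<one>\<^bsub>BijGroup UNIV\<^esub> v"
    by (simp add: BijGroup_def)
  ultimately show ?thesis
    unfolding weyl_orbit_def by blast
qed

lemma reflection_weyl_orbit:
  assumes "i \<le> 4" "u \<in> weyl_orbit \<alpha> coroot v"
  shows "simple_reflection \<alpha> coroot i u \<in> weyl_orbit \<alpha> coroot v"
proof -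
  let ?s = "simple_reflection \<alpha> coroot i"
  obtain w where w: "w \<in> weyl_group \<alpha> coroot" "u = w v"
    using assms(2) by (auto simp: weyl_orbit_def)
  have "?s \<otimes>\<^bsub>BijGroup UNIV\<^esub> w \<in> weyl_group \<alpha> coroot"
    unfolding weyl_group_def
  proof (rule generate.eng)
    show "?s \<in> generate (BijGroup UNIV) (simple_reflection \<alpha> coroot ` {..4})"
      using assms(1) by (intro generate.incl) auto
  qed (use w(1) in \<open>simp add: weyl_group_def\<close>)
  moreover have "(?s \<otimes>\<^bsub>BijGroup UNIV\<^esub> w) v = ?s u"
    using w weyl_group_carrier simple_reflection_in_BijGroup[OF assms(1)] by (auto simp: BijGroup_mult)
  ultimately show ?thesis
    unfolding weyl_orbit_def by (intro CollectI exI conjI) (rule sym)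
qed

text \<open>One inclusion is closure of \<open>two_odd\<close> under reflections. The other is
  descent: as long as some pairing is negative, a reflection lowers the nonnegative
  \<open>shifted_norm\<close>, and the only dominant vector left is that of
  \<open>\<Lambda> 2\<close>.\<close>

lemma weyl_orbit_eq: "weyl_orbit \<alpha> coroot (\<Lambda> 2) = weight ` two_odd"
proof
  show "weyl_orbit \<alpha> coroot (\<Lambda> 2) \<subseteq> weight ` two_odd"
  proof (rule weyl_orbit_subset)
    have "(1, 1, 0, 0) \<in> two_odd"
      by (simp add: two_odd_def)
    then show "\<Lambda> 2 \<in> weight ` two_odd"
      by (metis weight_base imageI)
  qed (auto simp: reflection_weight reflect_two_odd)
next
  have "weight v \<in> weyl_orbit \<alpha> coroot (\<Lambda> 2)" if "v \<in> two_odd" for v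
    using that
  proof (induction "nat (shifted_norm X v)" arbitrary: v rule: less_induct)
    case less
    show ?case
    proof (cases "\<forall>i\<le>4. 0 \<le> pairing X i v")
      case True
      then have "v = (1, 1, 0, 0)"
        using less.prems by (intro dominant_two_odd) auto
      then show ?thesis
        by (simp add: weight_base self_in_weyl_orbit)
    next
      case False
      then obtain i where i: "i \<le> 4" "pairing X i v < 0"
        by (auto simp: not_le)
      have "shifted_norm X (reflect X i v) < shifted_norm X v"
        using i by (cases X) (simp_all add: shifted_norm_reflect)
      then have "nat (shifted_norm X (reflect X i v)) < nat (shifted_norm X v)"
        using shifted_norm_nonneg[of X "reflect X i v"] by simp
      then have "weight (reflect X i v) \<in> weyl_orbit \<alpha> coroot (\<Lambda> 2)"
        using less.prems i by (intro less.hyps reflect_two_odd)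
      then have "simple_reflection \<alpha> coroot i (weight (reflect X i v)) \<in> weyl_orbit \<alpha> coroot (\<Lambda> 2)"
        using i by (intro reflection_weyl_orbit)
      then show ?thesis
        using i reflection_weight[of i v] reflection_involution[of i "weight v"] by simp
    qed
  qed
  then show "weight ` two_odd \<subseteq> weyl_orbit \<alpha> coroot (\<Lambda> 2)"
    by blast
qed

lemma card_cores:
  "card (cores \<alpha> coroot \<Lambda> 2 N) = card {v \<in> two_odd. shifted_norm X v = height_norm X (int N)}"
proof -
  have "cores \<alpha> coroot \<Lambda> 2 N = weight ` {v \<in> two_odd. shifted_norm X v = height_norm X (int N)}"
    unfolding cores_def weyl_orbit_eq by (auto simp: ht_weight_iff)
  then show ?thesis
    by (simp add: card_image inj_on_subset[OF inj_weight])
qed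

end

section \<open>Counting the cores\<close>

lemma card_eq_double_involution:
  assumes "finite S"
    and "\<And>x. x \<in> S \<Longrightarrow> f x \<in> S \<and> f (f x) = x \<and> (f x \<in> T \<longleftrightarrow> x \<notin> T)"
  shows "card S = 2 * card (S \<inter> T)"
proof -
  have "bij_betw f (S \<inter> T) (S - T)"
    by (rule bij_betw_byWitness[where f' = f]) (use assms(2) in auto)
  then have "card (S - T) = card (S \<inter> T)"
    by (rule bij_betw_same_card[symmetric])
  moreover have "card S = card (S \<inter> T) + card (S - T)"
    using assms(1) by (rule card_Int_Diff)
  ultimately show ?thesis
    by simp
qed

text \<open>The map \<open>v\<close> -> \<open>4 * v - \<rho>\<close> identifies all integer vectors
  with one residue class modulo 4; \<open>-\<rho>\<close> has the residues 0, 1, 2, 3.\<close>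

lemma card_shifted_norm_B4:
  "card {v. shifted_norm B4_1 v = n} = reps n (\<lambda>a b c d. a mod 4 = 0 \<and> b mod 4 = 1 \<and> c mod 4 = 2 \<and> d mod 4 = 3)"
  (is "card ?V = reps n ?Q")
proof -
  have "bij_betw (\<lambda>(a, b, c, d). (4 * a - 4, 4 * b - 3, 4 * c - 2, 4 * d - 1)) ?V
      {(a, b, c, d). a\<^sup>2 + b\<^sup>2 + c\<^sup>2 + d\<^sup>2 = n \<and> ?Q a b c d}"
  proof (rule bij_betw_byWitness[where f' = "\<lambda>(a, b, c, d). ((a + 4) div 4, (b + 3) div 4, (c + 2) div 4, (d + 1) div 4)"])
    have "(4 * x - 4) mod 4 = 0" "(4 * x - 3) mod 4 = 1" "(4 * x - 2) mod 4 = 2" "(4 * x - 1) mod 4 = 3" for x :: int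
      by presburger+
    then show "(\<lambda>(a, b, c, d). (4 * a - 4, 4 * b - 3, 4 * c - 2, 4 * d - 1)) ` ?V
        \<subseteq> {(a, b, c, d). a\<^sup>2 + b\<^sup>2 + c\<^sup>2 + d\<^sup>2 = n \<and> ?Q a b c d}"
      by auto
    have div: "x mod 4 = 0 \<Longrightarrow> 4 * ((x + 4) div 4) - 4 = x" "x mod 4 = 1 \<Longrightarrow> 4 * ((x + 3) div 4) - 3 = x"
      "x mod 4 = 2 \<Longrightarrow> 4 * ((x + 2) div 4) - 2 = x" "x mod 4 = 3 \<Longrightarrow> 4 * ((x + 1) div 4) - 1 = x" for x :: int
      by presburger+
    show "(\<lambda>(a, b, c, d). ((a + 4) div 4, (b + 3) div 4, (c + 2) div 4, (d + 1) div 4)) `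
        {(a, b, c, d). a\<^sup>2 + b\<^sup>2 + c\<^sup>2 + d\<^sup>2 = n \<and> ?Q a b c d} \<subseteq> ?V"
      by (clarsimp simp: div)
    show "\<forall>v\<in>{(a, b, c, d). a\<^sup>2 + b\<^sup>2 + c\<^sup>2 + d\<^sup>2 = n \<and> ?Q a b c d}.
        (\<lambda>(a, b, c, d). (4 * a - 4, 4 * b - 3, 4 * c - 2, 4 * d - 1))
          ((\<lambda>(a, b, c, d). ((a + 4) div 4, (b + 3) div 4, (c + 2) div 4, (d + 1) div 4)) v) = v"
      by (clarsimp simp: div)
  qed simp
  then show ?thesis
    unfolding reps_def by (rule bij_betw_same_card)
qed

lemma card_shifted_norm_D4:
  "card {v. shifted_norm D4_1 v = n} = reps n (\<lambda>a b c d. a mod 3 = 0 \<and> b mod 3 = 1 \<and> c mod 3 = 2 \<and> d mod 3 = 0)"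
  (is "card ?V = reps n ?Q")
proof -
  have "bij_betw (\<lambda>(a, b, c, d). (3 * a - 3, 3 * b - 2, 3 * c - 1, 3 * d)) ?V
      {(a, b, c, d). a\<^sup>2 + b\<^sup>2 + c\<^sup>2 + d\<^sup>2 = n \<and> ?Q a b c d}"
  proof (rule bij_betw_byWitness[where f' = "\<lambda>(a, b, c, d). ((a + 3) div 3, (b + 2) div 3, (c + 1) div 3, d div 3)"])
    have "(3 * x - 3) mod 3 = 0" "(3 * x - 2) mod 3 = 1" "(3 * x - 1) mod 3 = 2" for x :: int
      by presburger+
    then show "(\<lambda>(a, b, c, d). (3 * a - 3, 3 * b - 2, 3 * c - 1, 3 * d)) ` ?V
        \<subseteq> {(a, b, c, d). a\<^sup>2 + b\<^sup>2 + c\<^sup>2 + d\<^sup>2 = n \<and> ?Q a b c d}"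
      by auto
    have div: "x mod 3 = 0 \<Longrightarrow> 3 * ((x + 3) div 3) - 3 = x" "x mod 3 = 1 \<Longrightarrow> 3 * ((x + 2) div 3) - 2 = x"
      "x mod 3 = 2 \<Longrightarrow> 3 * ((x + 1) div 3) - 1 = x" "x mod 3 = 0 \<Longrightarrow> 3 * (x div 3) = x" for x :: int
      by presburger+
    show "(\<lambda>(a, b, c, d). ((a + 3) div 3, (b + 2) div 3, (c + 1) div 3, d div 3)) `
        {(a, b, c, d). a\<^sup>2 + b\<^sup>2 + c\<^sup>2 + d\<^sup>2 = n \<and> ?Q a b c d} \<subseteq> ?V"
      by (clarsimp simp: div simp del: power_mult_distrib)
    show "\<forall>v\<in>{(a, b, c, d). a\<^sup>2 + b\<^sup>2 + c\<^sup>2 + d\<^sup>2 = n \<and> ?Q a b c d}.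
        (\<lambda>(a, b, c, d). (3 * a - 3, 3 * b - 2, 3 * c - 1, 3 * d))
          ((\<lambda>(a, b, c, d). ((a + 3) div 3, (b + 2) div 3, (c + 1) div 3, d div 3)) v) = v"
      by (clarsimp simp: div)
  qed simp
  then show ?thesis
    unfolding reps_def by (rule bij_betw_same_card)
qed

text \<open>Solving for \<open>N\<close> leaves only \<open>3 * b\<close>, \<open>d\<close> and the
  constant 3 modulo 2.\<close>

lemma shifted_norm_B4_parity:
  assumes "shifted_norm B4_1 (a, b, c, d) = 8 * int N + 6"
  shows "even N \<longleftrightarrow> odd (b + d)"
proof -
  define w where "w = a\<^sup>2 + b\<^sup>2 + c\<^sup>2 + d\<^sup>2"
  have "int N = 2 * w - 4 * a - 3 * b - 2 * c - d + 3"
    using assms by (simp add: w_def power2_eq_square algebra_simps)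
  then show ?thesis
    by presburger
qed

lemma finite_shifted_norm_B4: "finite {v. shifted_norm B4_1 v = n}"
proof (rule finite_subset)
  show "{v. shifted_norm B4_1 v = n}
      \<subseteq> (\<lambda>(a, b, c, d). (4 * a - 4, 4 * b - 3, 4 * c - 2, 4 * d - 1)) -` {(a, b, c, d). a\<^sup>2 + b\<^sup>2 + c\<^sup>2 + d\<^sup>2 = n \<and> True}"
    by auto
  show "finite \<dots>"
    by (rule finite_vimageI[OF finite_reps]) (auto simp: inj_def)
qed

text \<open>The parity of \<open>N\<close> prescribes the parity of \<open>b + d\<close>. The symmetry \<open>c \<mapsto> 1 - c\<close> halves the solutions
  according to the parity of \<open>a + c\<close>; for odd \<open>N\<close> the symmetry \<open>(b, d) \<mapsto> (1 - d, 1 - b)\<close> then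
  exchanges the two odd and the two even values among \<open>b\<close>, \<open>d\<close>.\<close>

lemma card_two_odd_B4:
  "card {v. shifted_norm B4_1 v = 8 * int N + 6}
    = (if even N then 2 else 4) * card {v \<in> two_odd. shifted_norm B4_1 v = 8 * int N + 6}"
proof -
  define V where "V = {v. shifted_norm B4_1 v = 8 * int N + 6}"
  have finV: "finite V"
    unfolding V_def by (rule finite_shifted_norm_B4)
  have par: "even N \<longleftrightarrow> odd (b + d)" if "(a, b, c, d) \<in> V" for a b c d
    using that shifted_norm_B4_parity unfolding V_def by blast
  have V_int: "V \<inter> two_odd = {v \<in> two_odd. shifted_norm B4_1 v = 8 * int N + 6}"
    by (auto simp: V_def)
  let ?f = "\<lambda>(a, b, c, d). (a, b, 1 - c, d) :: int \<times> int \<times> int \<times> int"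
  have fV: "?f v \<in> V \<and> ?f (?f v) = v" if "v \<in> V" for v
    using that by (cases v) (auto simp: V_def power2_eq_square algebra_simps)
  show ?thesis
  proof (cases "even N")
    case True
    have "card V = 2 * card (V \<inter> two_odd)"
    proof (rule card_eq_double_involution[where f = ?f, OF finV])
      fix v
      assume v: "v \<in> V"
      obtain a b c d where abcd: "v = (a, b, c, d)"
        by (cases v)
      have "odd (b + d)"
        using par True v abcd by blast
      then have "?f v \<in> two_odd \<longleftrightarrow> v \<notin> two_odd"
        by (cases "even a"; cases "even b"; cases "even c"; cases "even d"; simp add: abcd two_odd_def mod_2_eq_odd)
      then show "?f v \<in> V \<and> ?f (?f v) = v \<and> (?f v \<in> two_odd \<longleftrightarrow> v \<notin> two_odd)"
        using fV[OF v] by blast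
    qed
    then show ?thesis
      using True V_int V_def by simp
  next
    case False
    define E :: "(int \<times> int \<times> int \<times> int) set" where "E = {(a, b, c, d). even (a + c)}"
    have "card V = 2 * card (V \<inter> E)"
    proof (rule card_eq_double_involution[where f = ?f, OF finV])
      fix v
      assume v: "v \<in> V"
      have "?f v \<in> E \<longleftrightarrow> v \<notin> E"
        by (cases v) (auto simp: E_def)
      then show "?f v \<in> V \<and> ?f (?f v) = v \<and> (?f v \<in> E \<longleftrightarrow> v \<notin> E)"
        using fV[OF v] by blast
    qed
    also have "card (V \<inter> E) = 2 * card ((V \<inter> E) \<inter> two_odd)"
    proof (rule card_eq_double_involution)
      let ?g = "\<lambda>(a, b, c, d). (a, 1 - d, c, 1 - b) :: int \<times> int \<times> int \<times> int"
      show "finite (V \<inter> E)"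
        using finV by blast
      fix v
      assume v: "v \<in> V \<inter> E"
      obtain a b c d where abcd: "v = (a, b, c, d)"
        by (cases v)
      have "even (b + d)" "even (a + c)"
        using par False v abcd by (auto simp: E_def)
      then have "?g v \<in> two_odd \<longleftrightarrow> v \<notin> two_odd"
        by (cases "even a"; cases "even b"; cases "even c"; cases "even d"; simp add: abcd two_odd_def mod_2_eq_odd)
      moreover have "?g v \<in> V" "?g (?g v) = v" "?g v \<in> E"
        using v by (auto simp: abcd V_def E_def power2_eq_square algebra_simps)
      ultimately show "?g v \<in> V \<inter> E \<and> ?g (?g v) = v \<and> (?g v \<in> two_odd \<longleftrightarrow> v \<notin> two_odd)"
        by blast
    qed
    \<comment> \<open>Here \<open>b\<close> and \<open>d\<close> have equal parity, so two odd
      entries in total force \<open>a\<close> and \<open>c\<close> to have equal parity as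
      well.\<close>
    also have "(V \<inter> E) \<inter> two_odd = V \<inter> two_odd"
    proof -
      have "v \<in> E" if v: "v \<in> V" "v \<in> two_odd" for v
      proof -
        obtain a b c d where abcd: "v = (a, b, c, d)"
          by (cases v)
        have "even (b + d)"
          using par False v abcd by blast
        with v show ?thesis
          by (cases "even a"; cases "even b"; cases "even c"; cases "even d"; simp add: abcd two_odd_def E_def mod_2_eq_odd)
      qed
      then show ?thesis
        by blast
    qed
    finally show ?thesis
      using False V_int V_def by simp
  qed
qed

text \<open>For odd \<open>N\<close> the equation gives \<open>w \<equiv> 2 * (a + c + 1)\<close>
  modulo 4, and \<open>w\<close> is congruent to the number of odd entries. If \<open>a + c\<close>
  were odd, that number would be divisible by 4, although exactly one of \<open>a\<close>,
  \<open>c\<close> is odd and so it lies between 1 and 3. Hence it is 2 modulo 4.\<close>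

lemma shifted_norm_D4_two_odd:
  assumes "shifted_norm D4_1 v = 6 * int N + 2" "odd N"
  shows "v \<in> two_odd"
proof -
  obtain a b c d where v: "v = (a, b, c, d)"
    by (cases v)
  define w where "w = a\<^sup>2 + b\<^sup>2 + c\<^sup>2 + d\<^sup>2"
  have "6 * int N = 9 * w - 18 * a - 12 * b - 6 * c + 12"
    using assms(1) by (simp add: v w_def power2_eq_square algebra_simps)
  moreover obtain k where "int N = 2 * k + 1"
    using assms(2) by (metis even_of_nat oddE)
  ultimately have "12 * k = 9 * w - 18 * a - 12 * b - 6 * c + 6"
    by simp
  then have "4 * k = 3 * w - 6 * a - 4 * b - 2 * c + 2"
    by simp
  then have "w = 2 * (a + c + 1) + 4 * (w - k - 2 * a - b - c)"
    by simp
  then have "w mod 4 = (2 * (a + c + 1)) mod 4"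
    by (metis mod_mult_self2)
  also have "\<dots> = (if even (a + c) then 2 else 0)"
  proof -
    have "(2 * x) mod 4 = (if even x then 0 else 2)" for x :: int
      by presburger
    then have "(2 * (a + c + 1)) mod 4 = (if even (a + c + 1) then 0 else 2)" .
    moreover have "even (a + c + 1) \<longleftrightarrow> odd (a + c)"
      by simp
    ultimately show ?thesis
      by (cases "even (a + c)") (simp_all only: if_True if_False simp_thms)
  qed
  finally have "(a mod 2 + b mod 2 + c mod 2 + d mod 2) mod 4 = (if even (a + c) then 2 else 0)"
    by (simp add: w_def sum_squares_mod_4)
  then show ?thesis
    by (cases "even a"; cases "even b"; cases "even c"; cases "even d"; simp add: v two_odd_def mod_2_eq_odd)
qed

theorem theorem5p19:
  fixes X :: affine_type
    and \<alpha> :: "nat \<Rightarrow> 'v::real_vector"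
    and coroot :: "nat \<Rightarrow> 'v \<Rightarrow> real"
    and \<Lambda> :: "nat \<Rightarrow> 'v"
    and N :: nat
  assumes "realization X \<alpha> coroot \<Lambda>"
  shows "(X = B4_1 \<and> even N \<longrightarrow>
            real (card (cores \<alpha> coroot \<Lambda> 2 N)) = 1 / 96 * real (r4 (8 * N + 6)) \<and>
            1 / 96 * real (r4 (8 * N + 6)) = 1 / 4 * real (odd_divisor_sum (8 * N + 6))) \<and>
         (X = B4_1 \<and> odd N \<longrightarrow>
            real (card (cores \<alpha> coroot \<Lambda> 2 N)) = 1 / 192 * real (r4 (8 * N + 6)) \<and>
            1 / 192 * real (r4 (8 * N + 6)) = 1 / 8 * real (odd_divisor_sum (8 * N + 6))) \<and>
         (X = D4_1 \<and> odd N \<longrightarrow>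
            real (card (cores \<alpha> coroot \<Lambda> 2 N)) = 1 / 24 * real (r4 (6 * N + 2)) \<and>
            1 / 24 * real (r4 (6 * N + 2)) = real (odd_divisor_sum (6 * N + 2)))"
proof -
  interpret realization X \<alpha> coroot \<Lambda>
    by (fact assms)
  let ?cores = "card (cores \<alpha> coroot \<Lambda> 2 N)"
  have jacobi: "r4 (8 * N + 6) = 24 * odd_divisor_sum (8 * N + 6)"
    "r4 (6 * N + 2) = 24 * odd_divisor_sum (6 * N + 2)"
    by (simp_all add: r4_even)
  \<comment> \<open>The factor 48 from the residue pattern times 2 or 4 from the parity condition
    gives the denominators 96 and 192.\<close>
  have B: "r4 (8 * N + 6) = 48 * ((if even N then 2 else 4) * ?cores)" if "X = B4_1"
  proof -
    have "int (8 * N + 6) mod 8 = 6"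
      by simp
    then have "r4 (8 * N + 6) = 48 * card {v. shifted_norm B4_1 v = int (8 * N + 6)}"
      unfolding r4_eq_reps card_shifted_norm_B4 by (rule reps_residues_mod_4)
    then show ?thesis
      using card_two_odd_B4[of N] by (simp add: card_cores that)
  qed
  \<comment> \<open>For odd \<open>N\<close> every solution already lies in \<open>two_odd\<close>,
    so the residue factor 24 is the whole denominator.\<close>
  have D: "r4 (6 * N + 2) = 24 * ?cores" if "X = D4_1" "odd N"
  proof -
    have "{v \<in> two_odd. shifted_norm D4_1 v = 6 * int N + 2} = {v. shifted_norm D4_1 v = 6 * int N + 2}"
      using shifted_norm_D4_two_odd[OF _ that(2)] by blast
    moreover have "int (6 * N + 2) mod 3 = 2"
      by (simp, presburger)
    then have "r4 (6 * N + 2) = 24 * card {v. shifted_norm D4_1 v = int (6 * N + 2)}"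
      unfolding r4_eq_reps card_shifted_norm_D4 by (rule reps_residues_mod_3)
    moreover have "int (6 * N + 2) = 6 * int N + 2"
      by simp
    ultimately show ?thesis
      unfolding card_cores by (simp only: that height_norm.simps)
  qed
  show ?thesis
    using B D jacobi by (auto simp: field_simps)
qed

end
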